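(* The naïve LZD construction algorithm and the naïve LZMW construction algorithm each take $\Omega(n^{5/4})$ time in the worst case; that is, for arbitrarily large $n$ there are input strings of length $n$ (over an alphabet whose size may grow with $n$) on which the algorithm runs in time $\Omega(n^{5/4})$.
   Context: LZD parsing of $s[1..n]$: $s=p_1\cdots p_z$, where with $k=|p_1\cdots p_{i-1}|+1$, $p_i=p_{i_1}p_{i_2}$ with $p_{i_1}$ the longest prefix of $s[k..n]$ in $\{p_1,\dots,p_{i-1}\}\cup\Sigma$ and $p_{i_2}$ the longest prefix of $s[k+|p_{i_1}|..n]$ in that set. LZMW parsing: $p_i$ is the longest prefix of $s[k..n]$ in $\{p_jp_{j+1}:1\le j\le i-2\}\cup\Sigma$. The naïve LZD algorithm maintains a compacted trie (edge labels stored as pairs of positions into the input, which is accessible by random access) containing the phrases computed so far and the distinct letters seen so far, with the nodes of these strings marked. To find each component $p_{i_1}$ (resp. $p_{i_2}$) starting at position $j$, it traverses the trie from the root, comparing letters of $s[j..n]$ with edge labels, as far as the match extends, and takes the string of the lowest marked node on the matched path (if nothing matches, the letter $s[j]$ is inserted as a new marked child of the root). After computing $p_i$, it inserts $p_i$ into the trie by traversing from the root along $p_i$, creating at most two nodes, and marking the node of $p_i$. The naïve LZMW algorithm is identical except that when computing $p_i$ the trie contains (marked) the strings $p_1p_2,\dots,p_{i-2}p_{i-1}$ (and the letters), and one longest marked match is taken per phrase. The running time counts all letter comparisons and trie-node steps. *)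

theory Defs
  imports Complex_Main
begin

text \<open>Strings are 0-indexed lists. The pair \<open>(b, e)\<close> denotes the factor \<open>s[b..<e]\<close> of the input \<open>s\<close>.
  An edge \<open>(b, e, t)\<close> of a compacted trie carries the (nonempty) label \<open>s[b..<e]\<close> and leads to \<open>t\<close>;
  it is selected among the outgoing edges of its node by the first letter of its label.\<close>

datatype 'a trie = Node (marked: bool) (edges: "'a \<rightharpoonup> nat \<times> nat \<times> 'a trie")

definition empty_trie :: "'a trie" where
  "empty_trie = Node False Map.empty"

definition leaf :: "'a trie" where
  "leaf = Node True Map.empty"

text \<open>Length of the longest common prefix of \<open>s[b..<e]\<close> and \<open>s[j..<h]\<close>.\<close>

function lcp :: "'a list \<Rightarrow> nat \<Rightarrow> nat \<Rightarrow> nat \<Rightarrow> nat \<Rightarrow> nat" where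
  "lcp s b e j h =
     (if b < e \<and> j < h \<and> s ! b = s ! j then Suc (lcp s (Suc b) e (Suc j) h) else 0)"
  by pat_completeness auto
termination by (relation "measure (\<lambda>(s, b, e, j, h). e - b)") auto

declare lcp.simps [simp del]

text \<open>Number of letter comparisons made when \<open>s[b..<e]\<close> and \<open>s[j..<h]\<close> are compared from left to
  right: the successful ones and, if neither string is exhausted, the final mismatch.\<close>

definition lcp_cost :: "'a list \<Rightarrow> nat \<Rightarrow> nat \<Rightarrow> nat \<Rightarrow> nat \<Rightarrow> nat" where
  "lcp_cost s b e j h =
     (let m = lcp s b e j h in if b + m < e \<and> j + m < h then Suc m else m)"

text \<open>In every traversal, visiting a node costs 1 (whatever its number of children) and each letter
  comparison costs 1. When an edge has been selected, its first letter has been compared (cost 1),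
  and the comparison proceeds with the rest of its label.

  \<open>search s r t j\<close> matches \<open>s[j..]\<close> downwards from the node \<open>t\<close>. It returns the position
  at which the string of the lowest marked node on the matched path ends (\<open>r\<close> if there is no marked
  node at or below \<open>t\<close> on that path), and the cost.\<close>

function search :: "'a list \<Rightarrow> nat \<Rightarrow> 'a trie \<Rightarrow> nat \<Rightarrow> nat \<times> nat" where
  "search s r (Node mk es) j =
     (let r' = (if mk then j else r) in
      if j < length s then
        (case es (s ! j) of
           None \<Rightarrow> (r', 1)
         | Some (b, e, t) \<Rightarrow>
             (let m = Suc (lcp s (Suc b) e (Suc j) (length s));
                  c = 2 + lcp_cost s (Suc b) e (Suc j) (length s)
              in if b + m = e
                 then (let (r'', c') = search s r' t (j + m) in (r'', c + c'))
                 else (r', c)))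
      else (r', 1))"
  by pat_completeness auto
termination by (relation "measure (\<lambda>(s, r, t, j). length s - j)") auto

declare search.simps [simp del]

text \<open>\<open>insert_factor s t j h\<close> inserts \<open>s[j..<h]\<close> below the node \<open>t\<close>, marks its node, and returns the
  new trie and the cost.\<close>

function insert_factor :: "'a list \<Rightarrow> 'a trie \<Rightarrow> nat \<Rightarrow> nat \<Rightarrow> 'a trie \<times> nat" where
  "insert_factor s (Node mk es) j h =
     (if j < h then
        (case es (s ! j) of
           None \<Rightarrow> (Node mk (es(s ! j \<mapsto> (j, h, leaf))), 1)
         | Some (b, e, t) \<Rightarrow>
             (let m = Suc (lcp s (Suc b) e (Suc j) h);
                  c = 2 + lcp_cost s (Suc b) e (Suc j) h
              in if b + m = e
                 then (let (t', c') = insert_factor s t (j + m) h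
                       in (Node mk (es(s ! j \<mapsto> (b, e, t'))), c + c'))
                 else (let lower = [s ! (b + m) \<mapsto> (b + m, e, t)];
                           mid = (if j + m = h then Node True lower
                                  else Node False (lower(s ! (j + m) \<mapsto> (j + m, h, leaf))))
                       in (Node mk (es(s ! j \<mapsto> (b, b + m, mid))), c))))
      else (Node True es, 1))"
  by pat_completeness auto
termination by (relation "measure (\<lambda>(s, t, j, h). h - j)") auto

declare insert_factor.simps [simp del]

text \<open>One longest marked match starting at position \<open>j\<close>: returns its end position, the trie (extended
  by the letter \<open>s ! j\<close> if nothing was found), and the cost. Since every letter seen so far is a marked
  child of the root, no marked node is found iff nothing matches.\<close>

definition find_component :: "'a list \<Rightarrow> 'a trie \<Rightarrow> nat \<Rightarrow> nat \<times> 'a trie \<times> nat" where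
  "find_component s t j =
     (let (r, c) = search s j t j in
      if r = j then (let (t', c') = insert_factor s t j (Suc j) in (Suc j, t', c + c'))
      else (r, t, c))"

lemma search_ge: "r \<le> j \<Longrightarrow> r \<le> fst (search s r t j)"
proof (induction s r t j rule: search.induct)
  case (1 s r mk es j)
  show ?case
  proof (cases "j < length s \<and> es (s ! j) \<noteq> None")
    case False
    then show ?thesis using "1.prems"
      by (auto simp: search.simps Let_def split: option.splits)
  next
    case True
    then obtain b e t where es: "es (s ! j) = Some (b, e, t)" by auto
    define m where "m = Suc (lcp s (Suc b) e (Suc j) (length s))"
    let ?r = "if mk then j else r"
    have IH: "?r \<le> fst (search s ?r t (j + m))" if "b + m = e"
      using "1.IH"[OF refl _ es refl refl refl refl] that True "1.prems" by (auto simp: m_def)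
    show ?thesis using IH True es "1.prems"
      by (auto simp: search.simps Let_def m_def split: prod.splits if_splits)
  qed
qed

lemma find_component_gt: "j < fst (find_component s t j)"
  using search_ge[of j j s t] by (auto simp: find_component_def Let_def split: prod.splits)

text \<open>The two algorithms return the phrases and the total cost. The loops are entered at the start
  \<open>k\<close> of a phrase. If the first component of an LZD phrase already ends at the end of the input, then
  the second one is empty and no search is made for it.\<close>

function lzd_loop :: "'a list \<Rightarrow> 'a trie \<Rightarrow> nat \<Rightarrow> 'a list list \<times> nat" where
  "lzd_loop s t k =
     (if k < length s then
        (let (k1, t1, c1) = find_component s t k;
             (k2, t2, c2) = (if k1 < length s then find_component s t1 k1 else (k1, t1, 0));
             (t3, c3) = insert_factor s t2 k k2;
             (ps, c) = lzd_loop s t3 k2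
         in (take (k2 - k) (drop k s) # ps, c1 + c2 + c3 + c))
      else ([], 0))"
  by pat_completeness auto
termination
proof (relation "measure (\<lambda>(s, t, k). length s - k)", goal_cases)
  case 1
  then show ?case by simp
next
  case (2 s t k x k1 y t1 c1 z k2 w t2 c2 v t3 c3)
  have "k < k1" using find_component_gt[of k s t] 2 by (metis fst_conv)
  moreover have "k1 \<le> k2"
    using find_component_gt[of k1 s t1] 2
    by (cases "k1 < length s") (metis fst_conv less_imp_le, simp)
  ultimately show ?case using 2 by auto
qed

declare lzd_loop.simps [simp del]

definition naive_lzd :: "'a list \<Rightarrow> 'a list list \<times> nat" where
  "naive_lzd s = lzd_loop s empty_trie 0"

text \<open>Here \<open>q\<close> is the start of the preceding phrase, if there is one.\<close>

function lzmw_loop :: "'a list \<Rightarrow> 'a trie \<Rightarrow> nat option \<Rightarrow> nat \<Rightarrow> 'a list list \<times> nat" where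
  "lzmw_loop s t q k =
     (if k < length s then
        (let (k1, t1, c1) = find_component s t k;
             (t2, c2) = (case q of None \<Rightarrow> (t1, 0) | Some a \<Rightarrow> insert_factor s t1 a k1);
             (ps, c) = lzmw_loop s t2 (Some k) k1
         in (take (k1 - k) (drop k s) # ps, c1 + c2 + c))
      else ([], 0))"
  by pat_completeness auto
termination
proof (relation "measure (\<lambda>(s, t, q, k). length s - k)", goal_cases)
  case 1
  then show ?case by simp
next
  case (2 s t q k x k1 y t1 c1 z t2 c2)
  have "k < k1" using find_component_gt[of k s t] 2 by (metis fst_conv)
  then show ?case using 2 by auto
qed

declare lzmw_loop.simps [simp del]

definition naive_lzmw :: "'a list \<Rightarrow> 'a list list \<times> nat" where
  "naive_lzmw s = lzmw_loop s empty_trie None 0"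

definition lzd_time :: "'a list \<Rightarrow> nat" where
  "lzd_time s = snd (naive_lzd s)"

definition lzmw_time :: "'a list \<Rightarrow> nat" where
  "lzmw_time s = snd (naive_lzmw s)"

end

theory Submission
  imports Defs "HOL-Library.Sublist"
begin

text \<open>
  A search is expensive if the text follows a long dictionary word far beyond the longest marked
  prefix. Take a word of length about \<open>3q\<^sup>2\<close> with distinct letters, cut into \<open>q\<close> blocks of length about
  \<open>3q\<close>, and put into the dictionary all its suffixes that start at block boundaries, extended by one
  more letter; this costs text of length \<open>O(q\<^sup>3)\<close>. Then let the text contain the word itself \<open>q\<close> times.
  If in round \<open>r\<close> a component starts at each block boundary, and the longest dictionary word there has
  length only \<open>3r + 1\<close>, then each of these \<open>q\<close> searches runs to the end of the word, and the round costs
  \<open>\<Omega>(q\<^sup>3)\<close>. The prefixes of the blocks grow slowly because in round \<open>r\<close> they are followed by a component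
  that is a single letter; the next component is again a letter, and the one after it is the rest of
  the block. Short additional pieces of text between the rounds lengthen the prefixes by two further
  letters, so that the next round uses fresh positions for the single letters. The string has length
  \<open>n = O(q\<^sup>3)\<close> and both algorithms need time \<open>\<Omega>(q\<^sup>4)\<close> on it, that is, even \<open>\<Omega>(n\<^bsup>4/3\<^esup>)\<close>.

  Both algorithms find the same components in this string: LZD inserts the concatenation of every
  second pair of consecutive components, LZMW that of every pair, and the components used are always
  available to LZD and longest for LZMW.
\<close>


section \<open>Tries\<close>

definition factor :: "'a list \<Rightarrow> nat \<Rightarrow> nat \<Rightarrow> 'a list" where
  "factor s b e = take (e - b) (drop b s)"

lemma length_factor [simp]: "e \<le> length s \<Longrightarrow> length (factor s b e) = e - b"
  by (simp add: factor_def)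

lemma nth_factor [simp]: "e \<le> length s \<Longrightarrow> i < e - b \<Longrightarrow> factor s b e ! i = s ! (b + i)"
  by (simp add: factor_def)

lemma factor_append: "b \<le> c \<Longrightarrow> c \<le> e \<Longrightarrow> factor s b c @ factor s c e = factor s b e"
proof -
  assume "b \<le> c" "c \<le> e"
  then have "e - b = (c - b) + (e - c)" "drop c s = drop (c - b) (drop b s)" by simp_all
  then show ?thesis unfolding factor_def by (simp only: take_add)
qed

lemma factor_self [simp]: "factor s j j = []"
  by (simp add: factor_def)

lemma prefix_drop_iff:
  "prefix u (drop j s) \<longleftrightarrow> j + length u \<le> length s \<and> u = factor s j (j + length u) \<or> u = []"
proof
  assume *: "prefix u (drop j s)"
  then have "length u \<le> length s - j" using prefix_length_le by fastforce
  moreover have "u = take (length u) (drop j s)" using * by (auto simp: prefix_def)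
  ultimately show "j + length u \<le> length s \<and> u = factor s j (j + length u) \<or> u = []"
    by (cases "j \<le> length s") (auto simp: factor_def)
next
  assume "j + length u \<le> length s \<and> u = factor s j (j + length u) \<or> u = []"
  then show "prefix u (drop j s)" by (metis factor_def take_is_prefix Nil_prefix)
qed

lemma lcp_props:
  fixes s :: "'a list" and b e j h :: nat
  defines "m \<equiv> lcp s b e j h"
  shows "m \<le> e - b" "m \<le> h - j" "i < m \<Longrightarrow> s ! (b + i) = s ! (j + i)"
    "b + m < e \<Longrightarrow> j + m < h \<Longrightarrow> s ! (b + m) \<noteq> s ! (j + m)"
proof -
  have "lcp s b e j h \<le> e - b \<and> lcp s b e j h \<le> h - j \<and>
    (\<forall>i < lcp s b e j h. s ! (b + i) = s ! (j + i)) \<and>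
    (b + lcp s b e j h < e \<longrightarrow> j + lcp s b e j h < h \<longrightarrow>
      s ! (b + lcp s b e j h) \<noteq> s ! (j + lcp s b e j h))"
  proof (induction s b e j h rule: lcp.induct)
    case (1 s b e j h)
    show ?case
    proof (cases "b < e \<and> j < h \<and> s ! b = s ! j")
      case False
      then show ?thesis by (subst (1 2 3 4 5 6 7) lcp.simps) auto
    next
      case True
      have eq: "lcp s b e j h = Suc (lcp s (Suc b) e (Suc j) h)"
        using True by (subst lcp.simps) simp
      show ?thesis using 1[OF True] True unfolding eq
        by (auto simp: less_Suc_eq_0_disj)
    qed
  qed
  then show "m \<le> e - b" "m \<le> h - j" "i < m \<Longrightarrow> s ! (b + i) = s ! (j + i)"
    "b + m < e \<Longrightarrow> j + m < h \<Longrightarrow> s ! (b + m) \<noteq> s ! (j + m)"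
    unfolding m_def by blast+
qed

lemma lcp_cost_ge: "lcp s b e j h \<le> lcp_cost s b e j h"
  by (simp add: lcp_cost_def Let_def)

section \<open>Well-formed tries and the strings of their marked nodes\<close>

inductive wf_trie :: "'a list \<Rightarrow> 'a trie \<Rightarrow> bool" for s where
  wf_Node: "(\<And>c b e t. es c = Some (b, e, t) \<Longrightarrow> b < e) \<Longrightarrow>
    (\<And>c b e t. es c = Some (b, e, t) \<Longrightarrow> e \<le> length s) \<Longrightarrow>
    (\<And>c b e t. es c = Some (b, e, t) \<Longrightarrow> s ! b = c) \<Longrightarrow>
    (\<And>c b e t. es c = Some (b, e, t) \<Longrightarrow> wf_trie s t) \<Longrightarrow> wf_trie s (Node mk es)"

text \<open>A word is what the path to a marked node spells, with the labels read from
  \<open>s\<close>. It is \<open>wf_trie\<close> that ties the key \<open>c\<close> to the first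
  letter of the label.\<close>

inductive word :: "'a list \<Rightarrow> 'a trie \<Rightarrow> 'a list \<Rightarrow> bool" for s where
  word_Nil: "word s (Node True es) []"
| word_step: "es c = Some (b, e, t) \<Longrightarrow> word s t w \<Longrightarrow> word s (Node mk es) (factor s b e @ w)"

lemma wf_Node_iff:
  "wf_trie s (Node mk es) \<longleftrightarrow>
    (\<forall>c b e t. es c = Some (b, e, t) \<longrightarrow> b < e \<and> e \<le> length s \<and> s ! b = c \<and> wf_trie s t)"
  by (subst wf_trie.simps) (simp, blast)

lemma word_Node_iff:
  "word s (Node mk es) w \<longleftrightarrow> mk \<and> w = [] \<or>
    (\<exists>c b e t w'. es c = Some (b, e, t) \<and> word s t w' \<and> w = factor s b e @ w')" (is "_ \<longleftrightarrow> ?R")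
proof
  assume "word s (Node mk es) w"
  then show ?R by cases blast+
qed (auto intro: word.intros)

lemma word_Node_Nil: "wf_trie s (Node mk es) \<Longrightarrow> word s (Node mk es) [] \<longleftrightarrow> mk"
proof -
  assume wf: "wf_trie s (Node mk es)"
  have "factor s b e \<noteq> []" if "es c = Some (b, e, t)" for c b e t
    using that wf unfolding wf_Node_iff factor_def by fastforce
  then show ?thesis unfolding word_Node_iff by auto
qed

lemma wf_empty [simp]: "wf_trie s empty_trie"
  by (simp add: empty_trie_def wf_Node_iff)

lemma word_empty [simp]: "\<not> word s empty_trie w"
  by (simp add: empty_trie_def word_Node_iff)

lemma wf_leaf [simp]: "wf_trie s leaf"
  by (simp add: leaf_def wf_Node_iff)

lemma word_leaf [simp]: "word s leaf w \<longleftrightarrow> w = []"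
  by (simp add: leaf_def word_Node_iff)

text \<open>The first letters of the edge label and of the text agree, so the true length of the match is
  one more than the \<open>lcp\<close> of the remainders.\<close>

lemma edge_match:
  fixes s :: "'a list" and b e j h :: nat
  assumes "b < e" "j < h" "s ! b = s ! j"
  defines "m \<equiv> Suc (lcp s (Suc b) e (Suc j) h)"
  shows "b + m \<le> e" "j + m \<le> h" "i < m \<Longrightarrow> s ! (b + i) = s ! (j + i)"
    "b + m < e \<Longrightarrow> j + m < h \<Longrightarrow> s ! (b + m) \<noteq> s ! (j + m)"
proof -
  note p = lcp_props[where s=s and b="Suc b" and e=e and j="Suc j" and h=h]
  show "b + m \<le> e" "j + m \<le> h" using p(1,2) assms(1,2) by (auto simp: m_def)
  show "i < m \<Longrightarrow> s ! (b + i) = s ! (j + i)" using p(3) assms(3)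
    by (cases i) (auto simp: m_def)
  show "b + m < e \<Longrightarrow> j + m < h \<Longrightarrow> s ! (b + m) \<noteq> s ! (j + m)"
    using p(4) by (auto simp: m_def)
qed

lemma edge_match_factor:
  fixes s :: "'a list" and b e j h :: nat
  assumes "b < e" "j < h" "s ! b = s ! j" "e \<le> length s" "h \<le> length s"
  defines "m \<equiv> Suc (lcp s (Suc b) e (Suc j) h)"
  shows "factor s b (b + m) = factor s j (j + m)"
proof -
  note em = edge_match[OF assms(1-3), folded m_def]
  show ?thesis using em(1,2,3) assms(4,5) by (intro nth_equalityI) auto
qed

text \<open>The search does not stop at the last marked node: it follows the text as long as some
  word does. The edge selected by the first letter of \<open>u\<close> is the one that
  \<open>w\<close> uses; either \<open>u\<close> ends within the matched part of its label, or the
  search below pays for the rest of \<open>u\<close>.\<close>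

lemma search_cost_ge:
  "wf_trie s t \<Longrightarrow> word s t w \<Longrightarrow> prefix u w \<Longrightarrow> prefix u (drop j s) \<Longrightarrow>
    length u \<le> snd (search s r t j)"
proof (induction s r t j arbitrary: w u rule: search.induct)
  case (1 s r mk es j)
  show ?case
  proof (cases "u = []")
    case False
    then have "w \<noteq> []" using "1.prems" by auto
    then obtain c b e t w' where es: "es c = Some (b, e, t)" "word s t w'" "w = factor s b e @ w'"
      using "1.prems"(2) unfolding word_Node_iff by metis
    have wf: "b < e" "e \<le> length s" "s ! b = c" "wf_trie s t"
      using "1.prems"(1) es(1) by (auto simp: wf_Node_iff)
    have u: "j + length u \<le> length s" "u = factor s j (j + length u)"
      using "1.prems"(4) False by (auto simp: prefix_drop_iff)
    have unth: "u ! i = s ! (j + i)" if "i < length u" for i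
      using that u by (metis nth_factor add_diff_cancel_left')
    have unth': "u ! i = w ! i" if "i < length u" for i
      using that "1.prems"(3) by (auto simp: prefix_def nth_append)
    have wnth: "w ! i = s ! (b + i)" if "i < e - b" for i
      using that wf es(3) by (auto simp: nth_append)
    have jl: "j < length s" using u(1) False by (cases u) auto
    have cj: "c = s ! j" using unth[of 0] unth'[of 0] wnth[of 0] False wf by auto
    define m where "m = Suc (lcp s (Suc b) e (Suc j) (length s))"
    define k where "k = 2 + lcp_cost s (Suc b) e (Suc j) (length s)"
    note em = edge_match[OF wf(1) jl wf(3)[unfolded cj], folded m_def]
    have km: "m \<le> k" using lcp_cost_ge[of s "Suc b" e "Suc j" "length s"] by (simp add: m_def k_def)
    show ?thesis
    proof (cases "b + m = e")
      case True
      have S: "snd (search s r (Node mk es) j) = k + snd (search s (if mk then j else r) t (j + m))"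
        using jl es(1) cj True
        by (auto simp: search.simps[of s r mk] Let_def m_def k_def split: prod.splits)
      show ?thesis
      proof (cases "length u \<le> m")
        case True
        then show ?thesis using S km by simp
      next
        case False
        have "prefix (drop m u) w'"
        proof -
          have "length (factor s b e) = m" using True wf by auto
          then show ?thesis using "1.prems"(3) es(3) False
            by (auto simp: prefix_def append_eq_append_conv2)
        qed
        moreover have "prefix (drop m u) (drop (j + m) s)"
        proof -
          obtain z where "drop j s = u @ z" using "1.prems"(4) by (auto simp: prefix_def)
          then have "drop m (drop j s) = drop m u @ z" using False by simp
          then show ?thesis by (auto simp: add.commute)
        qed
        ultimately have "length (drop m u) \<le> snd (search s (if mk then j else r) t (j + m))"
          using "1.IH"[OF refl jl es(1)[unfolded cj] refl refl m_def refl True wf(4) es(2)] by blast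
        then show ?thesis using S km by simp
      qed
    next
      case False
      have S: "snd (search s r (Node mk es) j) = k"
        using jl es(1) cj False
        by (auto simp: search.simps[of s r mk] Let_def m_def k_def split: prod.splits)
      have "length u \<le> m"
      proof (rule ccontr)
        assume "\<not> length u \<le> m"
        then have m: "m < length u" by simp
        then have "b + m < e" "j + m < length s" using em(1) False u(1) by auto
        then show False using em(4) unth[OF m] unth'[OF m] wnth[of m] by auto
      qed
      then show ?thesis using S km by simp
    qed
  qed simp
qed

section \<open>Longest marked matches and insertion\<close>

definition matches :: "'a list \<Rightarrow> 'a trie \<Rightarrow> nat \<Rightarrow> 'a list set" where
  "matches s t j = {v. word s t v \<and> prefix v (drop j s)}"

lemma matches_Node_None:
  assumes "wf_trie s (Node mk es)" "j \<ge> length s \<or> es (s ! j) = None"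
  shows "matches s (Node mk es) j = (if mk then {[]} else {})"
proof -
  have "w = []" if wm: "w \<in> matches s (Node mk es) j" for w
  proof (rule ccontr)
    assume ne: "w \<noteq> []"
    then obtain c b e t w' where es: "es c = Some (b, e, t)" "w = factor s b e @ w'"
      using wm unfolding matches_def word_Node_iff mem_Collect_eq by metis
    have wf: "b < e" "e \<le> length s" "s ! b = c"
      using assms(1) es(1) by (auto simp: wf_Node_iff)
    have w: "j + length w \<le> length s" "w = factor s j (j + length w)"
      using that ne by (auto simp: matches_def prefix_drop_iff)
    have "w ! 0 = s ! j" using w ne by (metis nth_factor add_diff_cancel_left' length_greater_0_conv add_0_right)
    moreover have "w ! 0 = c" using wf es(2) by (auto simp: nth_append)
    ultimately show False using assms(2) es(1) w ne by (cases w) auto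
  qed
  then show ?thesis using word_Node_Nil[OF assms(1)] by (force simp: matches_def)
qed


text \<open>No marked node lies inside an edge, so a label matched only in part contributes nothing,
  and a label matched completely passes the question on to the child.\<close>

lemma matches_Node_Some:
  assumes "wf_trie s (Node mk es)" "j < length s" "es (s ! j) = Some (b, e, t)"
  defines "m \<equiv> Suc (lcp s (Suc b) e (Suc j) (length s))"
  shows "matches s (Node mk es) j = (if mk then {[]} else {}) \<union>
    (if b + m = e then (@) (factor s b e) ` matches s t (j + m) else {})"
proof -
  have wf: "b < e" "e \<le> length s" "s ! b = s ! j" "wf_trie s t"
    using assms(1,3) by (auto simp: wf_Node_iff)
  note em = edge_match[OF wf(1) assms(2) wf(3), folded m_def]
  note ef = edge_match_factor[OF wf(1) assms(2) wf(3,2) order_refl, folded m_def]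
  have drop_eq: "drop j s = factor s b e @ drop (j + m) s" if "b + m = e"
    using ef that em(2) by (metis append_take_drop_id drop_drop factor_def add.commute add_diff_cancel_left')
  have 1: "w = [] \<or> (b + m = e \<and> w \<in> (@) (factor s b e) ` matches s t (j + m))"
    if wm: "w \<in> matches s (Node mk es) j" for w
  proof (cases "w = []")
    case False
    then obtain c b' e' t' w' where es: "es c = Some (b', e', t')" "word s t' w'"
      "w = factor s b' e' @ w'"
      using wm unfolding matches_def word_Node_iff mem_Collect_eq by metis
    have wf': "b' < e'" "e' \<le> length s" "s ! b' = c"
      using assms(1) es(1) by (auto simp: wf_Node_iff)
    have w: "j + length w \<le> length s" "w = factor s j (j + length w)"
      using that False by (auto simp: matches_def prefix_drop_iff)
    have wnth: "w ! i = s ! (j + i)" if "i < length w" for i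
      using that w by (metis nth_factor add_diff_cancel_left')
    have wnth': "w ! i = s ! (b' + i)" if "i < e' - b'" for i
      using that wf' es(3) by (auto simp: nth_append)
    have "c = s ! j" using wnth[of 0] wnth'[of 0] wf' False by auto
    then have [simp]: "b' = b" "e' = e" "t' = t" using es(1) assms(3) by auto
    have lw: "e - b \<le> length w" using es(3) wf by auto
    have "b + m = e"
    proof (rule ccontr)
      assume "b + m \<noteq> e"
      then have "b + m < e" using em(1) by simp
      moreover have "j + m < length s" using calculation lw w(1) by auto
      moreover have "m < length w" using calculation lw by simp
      ultimately show False using em(4) wnth[of m] wnth'[of m] by auto
    qed
    moreover have "w' \<in> matches s t (j + m)"
      using that es drop_eq[OF calculation] by (auto simp: matches_def)
    ultimately show ?thesis using es(3) by auto
  qed simp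
  have 2: "factor s b e @ w' \<in> matches s (Node mk es) j" if "b + m = e" "w' \<in> matches s t (j + m)" for w'
    using that assms(3) drop_eq[OF that(1)] by (auto simp: matches_def intro: word_step)
  have 3: "[] \<in> matches s (Node mk es) j \<longleftrightarrow> mk"
    using word_Node_Nil[OF assms(1)] by (simp add: matches_def)
  show ?thesis
  proof (intro set_eqI iffI)
    fix w assume "w \<in> matches s (Node mk es) j"
    then show "w \<in> (if mk then {[]} else {}) \<union>
        (if b + m = e then (@) (factor s b e) ` matches s t (j + m) else {})"
      using 1[of w] 3 by auto
  next
    fix w assume "w \<in> (if mk then {[]} else {}) \<union>
        (if b + m = e then (@) (factor s b e) ` matches s t (j + m) else {})"
    then show "w \<in> matches s (Node mk es) j" using 2 3 by (auto split: if_splits)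
  qed
qed

text \<open>The fallback \<open>r\<close> is returned if no marked node lies on the path. Passing a
  marked node resets it to the end of the match found there, and deeper matches override it by
  longer ones.\<close>

lemma search_longest:
  "wf_trie s t \<Longrightarrow>
    (if matches s t j = {} then fst (search s r t j) = r
     else \<exists>v\<in>matches s t j. fst (search s r t j) = j + length v \<and> (\<forall>v'\<in>matches s t j. length v' \<le> length v))"
proof (induction s r t j rule: search.induct)
  case (1 s r mk es j)
  show ?case
  proof (cases "j < length s \<and> es (s ! j) \<noteq> None")
    case False
    then have "fst (search s r (Node mk es) j) = (if mk then j else r)"
      by (auto simp: search.simps[of s r mk] Let_def split: option.splits)
    moreover have "matches s (Node mk es) j = (if mk then {[]} else {})"
      using matches_Node_None[OF "1.prems", of j] False by force
    ultimately show ?thesis by simp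
  next
    case True
    then obtain b e t where es: "es (s ! j) = Some (b, e, t)" by auto
    have jl: "j < length s" using True by simp
    have wf: "b < e" "e \<le> length s" "wf_trie s t"
      using "1.prems" es by (auto simp: wf_Node_iff)
    define m where "m = Suc (lcp s (Suc b) e (Suc j) (length s))"
    note M = matches_Node_Some[OF "1.prems" jl es, folded m_def]
    let ?r = "if mk then j else r"
    show ?thesis
    proof (cases "b + m = e")
      case True
      have S: "fst (search s r (Node mk es) j) = fst (search s ?r t (j + m))"
        using jl es True
        by (auto simp: search.simps[of s r mk] Let_def m_def split: prod.splits)
      note IH = "1.IH"[OF refl jl es refl refl m_def refl True wf(3)]
      have lf: "length (factor s b e) = m" using True wf by auto
      show ?thesis
      proof (cases "matches s t (j + m) = {}")
        case True
        then show ?thesis using IH unfolding S M by auto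
      next
        case False
        then obtain v where v: "v \<in> matches s t (j + m)" "fst (search s ?r t (j + m)) = j + m + length v"
          "\<forall>v'\<in>matches s t (j + m). length v' \<le> length v"
          using IH by auto
        have eq: "matches s (Node mk es) j =
            (if mk then {[]} else {}) \<union> (@) (factor s b e) ` matches s t (j + m)"
          using M True by simp
        have "factor s b e @ v \<in> matches s (Node mk es) j" unfolding eq using v(1) by blast
        moreover have "length v' \<le> length (factor s b e @ v)" if "v' \<in> matches s (Node mk es) j" for v'
          using that v(3) unfolding eq by (auto split: if_splits)
        moreover have "fst (search s r (Node mk es) j) = j + length (factor s b e @ v)"
          using S v(2) lf by simp
        ultimately show ?thesis by (metis empty_iff)
      qed
    next
      case False
      have S: "fst (search s r (Node mk es) j) = ?r"
        using jl es False
        by (auto simp: search.simps[of s r mk] Let_def m_def split: prod.splits)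
      show ?thesis using False unfolding S M by simp
    qed
  qed
qed

lemma insert_factor_spec:
  "wf_trie s t \<Longrightarrow> j \<le> h \<Longrightarrow> h \<le> length s \<Longrightarrow>
    wf_trie s (fst (insert_factor s t j h)) \<and>
    (\<forall>w. word s (fst (insert_factor s t j h)) w \<longleftrightarrow> word s t w \<or> w = factor s j h)"
proof (induction s t j h rule: insert_factor.induct)
  case (1 s mk es j h)
  note wf = "1.prems"(1)
  \<comment> \<open>The words through the edge with key \<open>c\<close> are separated from the
    others, which the insertion leaves alone.\<close>
  have upd: "word s (Node mk (es(c \<mapsto> (b, e, t)))) w \<longleftrightarrow>
      (mk \<and> w = [] \<or> (\<exists>w'. word s t w' \<and> w = factor s b e @ w') \<or>
       (\<exists>c' b e t w'. c' \<noteq> c \<and> es c' = Some (b, e, t) \<and> word s t w' \<and> w = factor s b e @ w'))"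
    for c b e t w
    unfolding word_Node_iff by (auto split: if_splits)
  have old: "word s (Node mk es) w \<longleftrightarrow>
      (mk \<and> w = [] \<or> (\<exists>b e t w'. es c = Some (b, e, t) \<and> word s t w' \<and> w = factor s b e @ w') \<or>
       (\<exists>c' b e t w'. c' \<noteq> c \<and> es c' = Some (b, e, t) \<and> word s t w' \<and> w = factor s b e @ w'))"
    for c w
    unfolding word_Node_iff by metis
  show ?case
  proof (cases "j < h")
    case False
    then show ?thesis using "1.prems"
      by (auto simp: insert_factor.simps[of s mk] wf_Node_iff word_Node_iff)
  next
    case jh: True
    show ?thesis
    proof (cases "es (s ! j)")
      case None
      have I: "fst (insert_factor s (Node mk es) j h) = Node mk (es(s ! j \<mapsto> (j, h, leaf)))"
        using jh None by (simp add: insert_factor.simps[of s mk])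
      have "wf_trie s (Node mk (es(s ! j \<mapsto> (j, h, leaf))))"
        using wf jh "1.prems"(3) by (auto simp: wf_Node_iff)
      then show ?thesis unfolding I upd old[of _ "s ! j"] using None by auto
    next
      case (Some x)
      then obtain b e t where es: "es (s ! j) = Some (b, e, t)" by (cases x) auto
      have wft: "b < e" "e \<le> length s" "s ! b = s ! j" "wf_trie s t"
        using wf es by (auto simp: wf_Node_iff)
      define m where "m = Suc (lcp s (Suc b) e (Suc j) h)"
      note em = edge_match[OF wft(1) jh wft(3), folded m_def]
      note ef = edge_match_factor[OF wft(1) jh wft(3,2) "1.prems"(3), folded m_def]
      have fj: "factor s j h = factor s b (b + m) @ factor s (j + m) h"
        using ef factor_append[of j "j + m" h s] em(2) by simp
      show ?thesis
      proof (cases "b + m = e")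
        case True
        define t' where "t' = fst (insert_factor s t (j + m) h)"
        have I: "fst (insert_factor s (Node mk es) j h) = Node mk (es(s ! j \<mapsto> (b, e, t')))"
          using jh es True
          by (auto simp: insert_factor.simps[of s mk] Let_def m_def t'_def split: prod.splits)
        have IH: "wf_trie s t'" "\<And>w. word s t' w \<longleftrightarrow> word s t w \<or> w = factor s (j + m) h"
          using "1.IH"[OF jh es refl refl m_def refl True wft(4) em(2) "1.prems"(3)]
          by (auto simp: t'_def)
        have "wf_trie s (Node mk (es(s ! j \<mapsto> (b, e, t'))))"
          using wf wft IH(1) by (auto simp: wf_Node_iff)
        then show ?thesis unfolding I upd old[of _ "s ! j"] using IH(2) es fj True by auto
      next
        case False
        then have bm: "b + m < e" using em(1) by simp
        define low where "low = [s ! (b + m) \<mapsto> (b + m, e, t)]"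
        define mid where "mid = (if j + m = h then Node True low
            else Node False (low(s ! (j + m) \<mapsto> (j + m, h, leaf))))"
        have I: "fst (insert_factor s (Node mk es) j h) = Node mk (es(s ! j \<mapsto> (b, b + m, mid)))"
          using jh es False
          by (auto simp: insert_factor.simps[of s mk] Let_def m_def low_def mid_def split: prod.splits)
        have wfm: "wf_trie s mid"
          using wft bm em(2) "1.prems"(3) by (auto simp: mid_def low_def wf_Node_iff)
        have wm: "word s mid w \<longleftrightarrow> (\<exists>w'. word s t w' \<and> w = factor s (b + m) e @ w') \<or> w = factor s (j + m) h"
          for w
        proof (cases "j + m = h")
          case True
          then show ?thesis by (auto simp: mid_def low_def word_Node_iff)
        next
          case False
          \<comment> \<open>The rest of the old label and the rest of the new string start with
            different letters, so the two entries of the map do not overwrite each other.\<close>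
          then have "s ! (b + m) \<noteq> s ! (j + m)" using em(2,4) bm by auto
          then show ?thesis using False
            by (auto simp: mid_def low_def word_Node_iff split: if_splits
                intro: exI[of _ "s ! (b + m)"] exI[of _ "s ! (j + m)"])
        qed
        have fb: "factor s b e @ w' = factor s b (b + m) @ factor s (b + m) e @ w'" for w'
          using factor_append[of b "b + m" e s] bm by (metis append.assoc le_add1 less_imp_le)
        have "wf_trie s (Node mk (es(s ! j \<mapsto> (b, b + m, mid))))"
          using wf wft wfm bm by (auto simp: wf_Node_iff m_def)
        then show ?thesis unfolding I upd old[of _ "s ! j"] using wm es fj fb by auto
      qed
    qed
  qed
qed

text \<open>A component of length 1 may be absent from the trie; then the search may fail and the
  letter is inserted. Hence the new words are only known to have length 1. The cost bound comes from
  \<open>search_cost_ge\<close>.\<close>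

lemma find_component_spec:
  assumes "wf_trie s t" "prefix c (drop j s)" "c \<noteq> []" "word s t c \<or> length c = 1"
    and "\<And>v. word s t v \<Longrightarrow> prefix v (drop j s) \<Longrightarrow> length v \<le> length c"
  shows "\<exists>t' k. find_component s t j = (j + length c, t', k) \<and> wf_trie s t' \<and>
    (\<forall>w. word s t w \<longrightarrow> word s t' w) \<and> (\<forall>w. word s t' w \<longrightarrow> word s t w \<or> length w = 1) \<and>
    (\<forall>w u. word s t w \<and> prefix u w \<and> prefix u (drop j s) \<longrightarrow> length u \<le> k)"
proof -
  obtain r k where rk: "search s j t j = (r, k)" by force
  have cost: "length u \<le> k" if "word s t w" "prefix u w" "prefix u (drop j s)" for w u
    using search_cost_ge[OF assms(1) that, of j] rk by simp
  have jc: "j + length c \<le> length s" using assms(2,3) by (auto simp: prefix_drop_iff)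
  have jl: "Suc j \<le> length s" using jc assms(3) by (cases c) auto
  have r0: "matches s t j = {} \<Longrightarrow> r = j" and
    r: "matches s t j \<noteq> {} \<Longrightarrow> \<exists>v\<in>matches s t j. r = j + length v \<and>
      (\<forall>v'\<in>matches s t j. length v' \<le> length v)"
    using search_longest[OF assms(1), where j=j and r=j] rk by simp_all
  have r1: "r = j + length c" if "word s t c"
  proof -
    have "c \<in> matches s t j" using that assms(2) by (simp add: matches_def)
    moreover from this have "matches s t j \<noteq> {}" by auto
    then obtain v where "v \<in> matches s t j" "r = j + length v"
      "\<forall>v'\<in>matches s t j. length v' \<le> length v" using r by blast
    ultimately show ?thesis using assms(5)[of v] by (auto simp: matches_def intro: antisym)
  qed
  show ?thesis
  proof (cases "r = j")
    case True
    then have l1: "length c = 1" using r1 assms(3,4) by auto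
    obtain t' k' where tk: "insert_factor s t j (Suc j) = (t', k')" by force
    have wf': "wf_trie s t'" and w': "word s t' w \<longleftrightarrow> word s t w \<or> w = factor s j (Suc j)" for w
      using insert_factor_spec[OF assms(1) _ jl, of j] tk by auto
    have "length (factor s j (Suc j)) = 1" using jl by simp
    moreover have "find_component s t j = (j + length c, t', k + k')"
      using True rk tk l1 by (simp add: find_component_def)
    ultimately show ?thesis using wf' w' cost by (fastforce intro: trans_le_add1)
  next
    case False
    then have ne: "matches s t j \<noteq> {}" using r0 by auto
    then obtain v where v: "v \<in> matches s t j" "r = j + length v" using r by blast
    have "length v \<le> length c" using v(1) assms(5) by (auto simp: matches_def)
    then have "r = j + length c" using r1 v False assms(3,4)
      by (metis One_nat_def Suc_leI add.right_neutral le_antisym length_greater_0_conv not_gr_zero)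
    then have "find_component s t j = (j + length c, t, k)"
      using False rk by (simp add: find_component_def)
    then show ?thesis using assms(1) cost by blast
  qed
qed

section \<open>A common run of both algorithms\<close>

text \<open>Such an \<open>a\<close> is the right choice for every dictionary between
  \<open>D\<close> and \<open>E\<close> (up to single letters): it is available even in
  \<open>D\<close>, and no word of \<open>E\<close> matches further.\<close>

definition component :: "'a list set \<Rightarrow> 'a list set \<Rightarrow> 'a list \<Rightarrow> 'a list \<Rightarrow> bool" where
  "component D E a u \<longleftrightarrow> a \<noteq> [] \<and> prefix a u \<and> (a \<in> D \<or> length a = 1) \<and>
     (\<forall>v\<in>E. prefix v u \<longrightarrow> length v \<le> length a)"

definition flat :: "('a list \<times> 'a list) list \<Rightarrow> 'a list" where
  "flat ps = concat (map (\<lambda>(a, b). a @ b) ps)"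

lemma flat_simps [simp]: "flat [] = []" "flat ((a, b) # ps) = a @ b @ flat ps"
  by (simp_all add: flat_def)

text \<open>\<open>parse D E q ps n\<close> describes a common run of both algorithms: consecutive components are grouped
  into the pairs \<open>ps\<close>, and \<open>q\<close> is the preceding component. LZD inserts the concatenation of each pair
  (recorded in \<open>D\<close>), LZMW the concatenation of any two consecutive components (recorded in \<open>E\<close>). Since
  \<open>D \<subseteq> E\<close> in every run, a component that is in \<open>D\<close> and longest in \<open>E\<close> is chosen by both algorithms.
  The number \<open>n\<close> bounds the costs of the searches for the first components of the pairs.\<close>

inductive parse :: "'a list set \<Rightarrow> 'a list set \<Rightarrow> 'a list \<Rightarrow> ('a list \<times> 'a list) list \<Rightarrow> nat \<Rightarrow> bool" where
  parse_Nil: "parse D E q [] 0"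
| parse_Cons: "component D E a (a @ b @ flat ps) \<Longrightarrow> component D (insert (q @ a) E) b (b @ flat ps) \<Longrightarrow>
    d = 0 \<or> (\<exists>w\<in>D. \<exists>u. prefix u w \<and> prefix u (a @ b @ flat ps) \<and> length u = d) \<Longrightarrow>
    parse (insert (a @ b) D) (insert (q @ a) (insert (a @ b) E)) b ps n \<Longrightarrow>
    parse D E q ((a, b) # ps) (d + n)"

lemma drop_add_length: "drop k s = a @ v \<Longrightarrow> drop (k + length a) s = v"
proof -
  assume "drop k s = a @ v"
  then have "drop (length a) (drop k s) = v" by simp
  then show ?thesis by (simp add: add.commute)
qed

lemma find_component_parse:
  assumes "component D E c (drop j s)" "wf_trie s t" "\<forall>w\<in>D. word s t w"
    and "\<forall>w. word s t w \<longrightarrow> w \<in> E \<or> length w = 1"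
  shows "\<exists>t' k. find_component s t j = (j + length c, t', k) \<and> wf_trie s t' \<and>
    (\<forall>w\<in>D. word s t' w) \<and> (\<forall>w. word s t' w \<longrightarrow> w \<in> E \<or> length w = 1) \<and>
    (\<forall>w\<in>D. \<forall>u. prefix u w \<and> prefix u (drop j s) \<longrightarrow> length u \<le> k) \<and>
    j + length c \<le> length s \<and> factor s j (j + length c) = c"
proof -
  have c: "c \<noteq> []" "prefix c (drop j s)" "c \<in> D \<or> length c = 1"
    "\<And>v. v \<in> E \<Longrightarrow> prefix v (drop j s) \<Longrightarrow> length v \<le> length c"
    using assms(1) by (auto simp: component_def)
  have longest: "length v \<le> length c" if "word s t v" "prefix v (drop j s)" for v
  proof -
    have "1 \<le> length c" using c(1) by (cases c) auto
    then show ?thesis using assms(4) that(1) c(4)[OF _ that(2)] by auto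
  qed
  have "word s t c \<or> length c = 1" using c(3) assms(3) by auto
  then obtain t' k where tk: "find_component s t j = (j + length c, t', k)" "wf_trie s t'"
    "\<forall>w. word s t w \<longrightarrow> word s t' w" "\<forall>w. word s t' w \<longrightarrow> word s t w \<or> length w = 1"
    "\<forall>w u. word s t w \<and> prefix u w \<and> prefix u (drop j s) \<longrightarrow> length u \<le> k"
    using find_component_spec[OF assms(2) c(2,1) _ longest] by blast
  have "j + length c \<le> length s" "factor s j (j + length c) = c"
    using c(1,2) by (auto simp: prefix_drop_iff)
  moreover have "\<forall>w\<in>D. word s t' w" using tk(3) assms(3) by blast
  moreover have "\<forall>w. word s t' w \<longrightarrow> w \<in> E \<or> length w = 1" using tk(4) assms(4) by blast
  moreover have "\<forall>w\<in>D. \<forall>u. prefix u w \<and> prefix u (drop j s) \<longrightarrow> length u \<le> k"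
    using tk(5) assms(3) by blast
  ultimately show ?thesis using tk(1,2) by blast
qed

text \<open>Invariant: the trie contains \<open>D\<close>, and its words are in \<open>E\<close> or
  single letters. LZD never inserts the words \<open>q @ a\<close>, but an upper bound
  \<open>E\<close> may contain them. Only the search for \<open>a\<close> is charged with
  \<open>d\<close>.\<close>

lemma lzd_loop_ge:
  "parse D E q ps n \<Longrightarrow> drop k s = flat ps \<Longrightarrow> wf_trie s t \<Longrightarrow>
    \<forall>w\<in>D. word s t w \<Longrightarrow> \<forall>w. word s t w \<longrightarrow> w \<in> E \<or> length w = 1 \<Longrightarrow>
    n \<le> snd (lzd_loop s t k)"
proof (induction D E q ps n arbitrary: t k rule: parse.induct)
  case (parse_Cons D E a b ps q d n)
  have ca: "component D E a (drop k s)" using parse_Cons.hyps(1) parse_Cons.prems(1) by simp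
  obtain t1 c1 where 1: "find_component s t k = (k + length a, t1, c1)" "wf_trie s t1"
    "\<forall>w\<in>D. word s t1 w" "\<forall>w. word s t1 w \<longrightarrow> w \<in> E \<or> length w = 1"
    "\<forall>w\<in>D. \<forall>u. prefix u w \<and> prefix u (drop k s) \<longrightarrow> length u \<le> c1"
    "k + length a \<le> length s" "factor s k (k + length a) = a"
    using find_component_parse[OF ca parse_Cons.prems(2-4)] by blast
  define k1 where "k1 = k + length a"
  have d1: "drop k1 s = b @ flat ps"
    using parse_Cons.prems(1) unfolding k1_def by (intro drop_add_length) simp
  have cb: "component D E b (drop k1 s)" using parse_Cons.hyps(2) d1 by (simp add: component_def)
  obtain t2 c2 where 2: "find_component s t1 k1 = (k1 + length b, t2, c2)" "wf_trie s t2"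
    "\<forall>w\<in>D. word s t2 w" "\<forall>w. word s t2 w \<longrightarrow> w \<in> E \<or> length w = 1"
    "\<forall>w\<in>D. \<forall>u. prefix u w \<and> prefix u (drop k1 s) \<longrightarrow> length u \<le> c2"
    "k1 + length b \<le> length s" "factor s k1 (k1 + length b) = b"
    using find_component_parse[OF cb 1(2-4)] by blast
  define k2 where "k2 = k1 + length b"
  have d2: "drop k2 s = flat ps"
    using d1 unfolding k2_def by (rule drop_add_length)
  have ne: "a \<noteq> []" "b \<noteq> []" using ca cb by (auto simp: component_def)
  obtain t3 c3 where 3: "insert_factor s t2 k k2 = (t3, c3)" by force
  have "factor s k k2 = a @ b" using factor_append[of k k1 k2 s] 1(7) 2(7) by (simp add: k1_def k2_def)
  then have w3: "wf_trie s t3" "\<And>w. word s t3 w \<longleftrightarrow> word s t2 w \<or> w = a @ b"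
    using insert_factor_spec[OF 2(2), of k k2] 3 2(6) by (auto simp: k1_def k2_def)
  have "n \<le> snd (lzd_loop s t3 k2)"
    using w3 2(3,4) by (intro parse_Cons.IH d2) auto
  moreover have "d \<le> c1"
    using parse_Cons.hyps(3)
  proof
    assume "\<exists>w\<in>D. \<exists>u. prefix u w \<and> prefix u (a @ b @ flat ps) \<and> length u = d"
    then obtain w u where "w \<in> D" "prefix u w" "prefix u (drop k s)" "length u = d"
      using parse_Cons.prems(1) by auto
    then show ?thesis using 1(5) by blast
  qed simp
  moreover have "snd (lzd_loop s t k) = c1 + c2 + c3 + snd (lzd_loop s t3 k2)"
  proof -
    have lt: "k < length s" "k1 < length s" using 1(6) 2(6) ne by (simp_all add: k1_def flip: length_greater_0_conv)
    show ?thesis using lt 1(1) 2(1) 3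
      by (subst lzd_loop.simps) (simp add: k1_def[symmetric] k2_def[symmetric] split: prod.splits)
  qed
  ultimately show ?case by simp
qed simp

text \<open>Each pair takes two iterations of the loop. The word \<open>q @ a\<close> enters the
  trie before \<open>b\<close> is searched, which is why the choice of \<open>b\<close> is checked
  against the enlarged set; \<open>p\<close> locates \<open>q\<close> in the text, if there is a
  preceding phrase.\<close>

lemma lzmw_loop_ge:
  "parse D E q ps n \<Longrightarrow> drop k s = flat ps \<Longrightarrow> wf_trie s t \<Longrightarrow>
    \<forall>w\<in>D. word s t w \<Longrightarrow> \<forall>w. word s t w \<longrightarrow> w \<in> E \<or> length w = 1 \<Longrightarrow>
    (\<And>i. p = Some i \<Longrightarrow> i \<le> k \<and> factor s i k = q) \<Longrightarrow>
    n \<le> snd (lzmw_loop s t p k)"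
proof (induction D E q ps n arbitrary: t k p rule: parse.induct)
  case (parse_Cons D E a b ps q d n)
  have ca: "component D E a (drop k s)" using parse_Cons.hyps(1) parse_Cons.prems(1) by simp
  obtain t1 c1 where 1: "find_component s t k = (k + length a, t1, c1)" "wf_trie s t1"
    "\<forall>w\<in>D. word s t1 w" "\<forall>w. word s t1 w \<longrightarrow> w \<in> E \<or> length w = 1"
    "\<forall>w\<in>D. \<forall>u. prefix u w \<and> prefix u (drop k s) \<longrightarrow> length u \<le> c1"
    "k + length a \<le> length s" "factor s k (k + length a) = a"
    using find_component_parse[OF ca parse_Cons.prems(2-4)] by blast
  define k1 where "k1 = k + length a"
  have d1: "drop k1 s = b @ flat ps"
    using parse_Cons.prems(1) unfolding k1_def by (intro drop_add_length) simp
  define E' where "E' = insert (q @ a) E"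
  obtain t1' c1' where ins: "(case p of None \<Rightarrow> (t1, 0) | Some i \<Rightarrow> insert_factor s t1 i k1) = (t1', c1')"
    by force
  have w1: "wf_trie s t1' \<and> (\<forall>w. word s t1 w \<longrightarrow> word s t1' w) \<and>
      (\<forall>w. word s t1' w \<longrightarrow> word s t1 w \<or> w = q @ a)"
  proof (cases p)
    case None
    then show ?thesis using ins 1(2) by simp
  next
    case (Some i)
    then have i: "i \<le> k" "factor s i k = q" using parse_Cons.prems(5) by auto
    have "factor s i k1 = q @ a" using factor_append[of i k k1 s] i 1(7) by (simp add: k1_def)
    then show ?thesis using insert_factor_spec[OF 1(2), of i k1] ins Some i(1) 1(6) by (auto simp: k1_def)
  qed
  have cb: "component D E' b (drop k1 s)" using parse_Cons.hyps(2) d1 by (simp add: component_def E'_def)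
  have wf1: "wf_trie s t1'" "\<forall>w\<in>D. word s t1' w" "\<forall>w. word s t1' w \<longrightarrow> w \<in> E' \<or> length w = 1"
    using w1 1(3,4) by (auto simp: E'_def)
  obtain t2 c2 where 2: "find_component s t1' k1 = (k1 + length b, t2, c2)" "wf_trie s t2"
    "\<forall>w\<in>D. word s t2 w" "\<forall>w. word s t2 w \<longrightarrow> w \<in> E' \<or> length w = 1"
    "\<forall>w\<in>D. \<forall>u. prefix u w \<and> prefix u (drop k1 s) \<longrightarrow> length u \<le> c2"
    "k1 + length b \<le> length s" "factor s k1 (k1 + length b) = b"
    using find_component_parse[OF cb wf1] by blast
  define k2 where "k2 = k1 + length b"
  have d2: "drop k2 s = flat ps"
    using d1 unfolding k2_def by (rule drop_add_length)
  have ne: "a \<noteq> []" "b \<noteq> []" using ca cb by (auto simp: component_def)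
  obtain t3 c3 where 3: "insert_factor s t2 k k2 = (t3, c3)" by force
  have "factor s k k2 = a @ b" using factor_append[of k k1 k2 s] 1(7) 2(7) by (simp add: k1_def k2_def)
  then have w3: "wf_trie s t3" "\<And>w. word s t3 w \<longleftrightarrow> word s t2 w \<or> w = a @ b"
    using insert_factor_spec[OF 2(2), of k k2] 3 2(6) by (auto simp: k1_def k2_def)
  have "n \<le> snd (lzmw_loop s t3 (Some k1) k2)"
    using w3 2(3,4,7) by (intro parse_Cons.IH d2) (auto simp: E'_def k2_def)
  moreover have "d \<le> c1"
    using parse_Cons.hyps(3)
  proof
    assume "\<exists>w\<in>D. \<exists>u. prefix u w \<and> prefix u (a @ b @ flat ps) \<and> length u = d"
    then obtain w u where "w \<in> D" "prefix u w" "prefix u (drop k s)" "length u = d"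
      using parse_Cons.prems(1) by auto
    then show ?thesis using 1(5) by blast
  qed simp
  moreover have "snd (lzmw_loop s t p k) = c1 + c1' + (c2 + c3 + snd (lzmw_loop s t3 (Some k1) k2))"
  proof -
    have lt: "k < length s" "k1 < length s" using 1(6) 2(6) ne by (simp_all add: k1_def flip: length_greater_0_conv)
    have "snd (lzmw_loop s t p k) = c1 + c1' + snd (lzmw_loop s t1' (Some k) k1)"
      using lt 1(1) ins
      by (subst lzmw_loop.simps) (simp add: k1_def[symmetric] split: prod.splits)
    also have "snd (lzmw_loop s t1' (Some k) k1) = c2 + c3 + snd (lzmw_loop s t3 (Some k1) k2)"
      using lt 2(1) 3
      by (subst lzmw_loop.simps) (simp add: k2_def[symmetric] split: prod.splits)
    finally show ?thesis .
  qed
  ultimately show ?case by simp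
qed simp

text \<open>Any \<open>q\<close> will do, since at the start there is no preceding phrase: both
  tries are empty, and \<open>lzmw_loop_ge\<close> is used with \<open>p = None\<close>.\<close>

lemma parse_time_ge:
  assumes "parse {} {} q ps n"
  shows "n \<le> lzd_time (flat ps)" "n \<le> lzmw_time (flat ps)"
  using lzd_loop_ge[OF assms, of 0 "flat ps" empty_trie]
    lzmw_loop_ge[OF assms, of 0 "flat ps" empty_trie None]
  by (simp_all add: lzd_time_def naive_lzd_def lzmw_time_def naive_lzmw_def)

section \<open>Texts made of interval runs\<close>

text \<open>A run \<open>(x, [(y1, z1), (y2, z2), \<dots>])\<close> stands for the string \<open>[x..<zk]\<close>, cut at \<open>y1, z1, y2, z2, \<dots>\<close> into
  an even number of components. In a text, each run is followed by two letters that occur nowhere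
  else. Hence a dictionary word that occurs again later is an interval \<open>[a..<b]\<close>, represented by \<open>(a, b)\<close>.
  The sets \<open>I\<close> and \<open>J\<close> below contain the intervals in the dictionaries of LZD and LZMW, respectively.\<close>

fun run_pairs :: "nat \<Rightarrow> (nat \<times> nat) list \<Rightarrow> (nat list \<times> nat list) list" where
  "run_pairs x [] = []"
| "run_pairs x ((y, z) # ys) = ([x..<y], [y..<z]) # run_pairs z ys"

fun run_end :: "nat \<Rightarrow> (nat \<times> nat) list \<Rightarrow> nat" where
  "run_end x [] = x"
| "run_end x ((y, z) # ys) = run_end z ys"

text \<open>\<open>I\<close> and \<open>J\<close> stay fixed along a run: words created within it
  start to the left of every later component and cannot match there. A word reaching beyond the end
  of the run is stopped by the separator.\<close>

fun run_ok :: "(nat \<times> nat) set \<Rightarrow> (nat \<times> nat) set \<Rightarrow> nat \<Rightarrow> (nat \<times> nat) list \<Rightarrow> bool" where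
  "run_ok I J x [] \<longleftrightarrow> True"
| "run_ok I J x ((y, z) # ys) \<longleftrightarrow> x < y \<and> y < z \<and> (y = Suc x \<or> (x, y) \<in> I) \<and> (z = Suc y \<or> (y, z) \<in> I) \<and>
     (\<forall>b. (x, b) \<in> J \<longrightarrow> b \<le> y \<or> run_end z ys < b) \<and>
     (\<forall>b. (y, b) \<in> J \<longrightarrow> b \<le> z \<or> run_end z ys < b) \<and> run_ok I J z ys"

fun paired_words :: "nat \<Rightarrow> (nat \<times> nat) list \<Rightarrow> (nat \<times> nat) set" where
  "paired_words x [] = {}"
| "paired_words x ((y, z) # ys) = insert (x, z) (paired_words z ys)"

text \<open>The words across pair boundaries, where \<open>p\<close> is the start of the preceding component. For the first
  component of a run, \<open>p\<close> is set to the start of the run, which only adds a word that is known anyway.\<close>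

fun bridging_words :: "nat \<Rightarrow> (nat \<times> nat) list \<Rightarrow> (nat \<times> nat) set" where
  "bridging_words p [] = {}"
| "bridging_words p ((y, z) # ys) = insert (p, y) (bridging_words y ys)"

text \<open>If a word from \<open>x\<close> reaches the end of the run, text and word agree up to
  the separator, and the search compares all letters between.\<close>

fun run_cost :: "(nat \<times> nat) set \<Rightarrow> nat \<Rightarrow> (nat \<times> nat) list \<Rightarrow> nat" where
  "run_cost I x [] = 0"
| "run_cost I x ((y, z) # ys) =
     (if \<exists>b\<ge>run_end z ys. (x, b) \<in> I then run_end z ys - x else 0) + run_cost I z ys"

type_synonym run = "nat \<times> (nat \<times> nat) list"

fun text_pairs :: "nat \<Rightarrow> run list \<Rightarrow> (nat list \<times> nat list) list" where
  "text_pairs F [] = []"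
| "text_pairs F ((x, ys) # R) = run_pairs x ys @ ([F], [Suc F]) # text_pairs (F + 2) R"

fun runs_ok :: "nat \<Rightarrow> (nat \<times> nat) set \<Rightarrow> (nat \<times> nat) set \<Rightarrow> run list \<Rightarrow> bool" where
  "runs_ok M I J [] \<longleftrightarrow> True"
| "runs_ok M I J ((x, ys) # R) \<longleftrightarrow> run_ok I J x ys \<and> run_end x ys \<le> M \<and>
     runs_ok M (I \<union> paired_words x ys) (J \<union> paired_words x ys \<union> bridging_words x ys) R"

fun runs_cost :: "(nat \<times> nat) set \<Rightarrow> run list \<Rightarrow> nat" where
  "runs_cost I [] = 0"
| "runs_cost I ((x, ys) # R) = run_cost I x ys + runs_cost (I \<union> paired_words x ys) R"

definition intervals :: "(nat \<times> nat) set \<Rightarrow> nat list set" where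
  "intervals I = (\<lambda>(a, b). [a..<b]) ` I"

text \<open>Words that contain one of the separating letters used so far.\<close>

definition spent :: "nat \<Rightarrow> nat \<Rightarrow> nat list set" where
  "spent M F = {w. \<exists>c\<in>set w. M \<le> c \<and> c < F}"

lemma run_end_ge: "run_ok I J x ys \<Longrightarrow> x \<le> run_end x ys"
  by (induction I J x ys rule: run_ok.induct) auto

lemma flat_append [simp]: "flat (ps @ qs) = flat ps @ flat qs"
  by (simp add: flat_def)

lemma upt_append_upt: "x \<le> y \<Longrightarrow> y \<le> z \<Longrightarrow> [x..<y] @ [y..<z] = [x..<z]"
  using upt_add_eq_append[of x y "z - y"] by simp

lemma flat_run_pairs: "run_ok I J x ys \<Longrightarrow> flat (run_pairs x ys) = [x..<run_end x ys]"
proof (induction I J x ys rule: run_ok.induct)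
  case (2 I J x y z ys)
  then have "x \<le> y" "y \<le> z" "z \<le> run_end z ys" using run_end_ge[of I J z ys] by auto
  then have "[x..<run_end z ys] = [x..<y] @ [y..<z] @ [z..<run_end z ys]"
    by (simp add: upt_append_upt)
  then show ?case using 2 by simp
qed simp

lemma set_flat_text_pairs:
  "runs_ok M I J R \<Longrightarrow> M < F \<Longrightarrow> set (flat (text_pairs F R)) \<inter> {M..<F} = {}"
proof (induction F R arbitrary: I J rule: text_pairs.induct)
  case (2 F x ys R)
  then have "set (flat (text_pairs (F + 2) R)) \<inter> {M..<F + 2} = {}" by auto
  then show ?case using 2 flat_run_pairs[of I J x ys] by fastforce
qed simp

lemma length_flat_text_pairs:
  "runs_ok M I J R \<Longrightarrow> length (flat (text_pairs F R)) = (\<Sum>(x, ys)\<leftarrow>R. run_end x ys - x + 2)"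
proof (induction F R arbitrary: I J rule: text_pairs.induct)
  case (2 F x ys R)
  then show ?case using flat_run_pairs[of I J x ys] by fastforce
qed simp

text \<open>Where an interval longer than the run would continue with the letter \<open>e\<close>,
  the text has the larger letter \<open>F\<close>.\<close>

lemma prefix_interval_run:
  assumes "prefix [a..<b] ([x..<e] @ F # v)" "a < b" "x < e" "e < F"
  shows "a = x" "b \<le> e"
proof -
  let ?u = "[x..<e] @ F # v"
  have nth: "a + i = ?u ! i" if "i < b - a" for i
  proof -
    obtain w where "?u = [a..<b] @ w" using assms(1) by (auto simp: prefix_def)
    then show ?thesis using that by (simp add: nth_append)
  qed
  show ax: "a = x" using nth[of 0] assms(2,3) by (simp add: nth_append)
  show "b \<le> e"
  proof (rule ccontr)
    assume "\<not> b \<le> e"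
    then have "e - x < b - a" using ax assms(3) by simp
    then show False using nth[of "e - x"] ax assms(3,4) by (simp add: nth_append)
  qed
qed

lemma spent_not_prefix: "w \<in> spent M F \<Longrightarrow> set u \<inter> {M..<F} = {} \<Longrightarrow> \<not> prefix w u"
  by (auto simp: spent_def prefix_def)

lemma component_interval:
  assumes "x < y" "y \<le> e" "e \<le> M" "M < F" "y = Suc x \<or> [x..<y] \<in> D"
    and "E \<subseteq> intervals J \<union> spent M F" "\<And>b. (x, b) \<in> J \<Longrightarrow> b \<le> y \<or> e < b" "set v \<inter> {M..<F} = {}"
  shows "component D E [x..<y] ([x..<e] @ F # v)"
proof -
  have "[x..<e] = [x..<y] @ [y..<e]" using assms(1,2) by (simp add: upt_append_upt)
  then have p: "prefix [x..<y] ([x..<e] @ F # v)" by (simp add: prefix_def)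
  have "length w \<le> y - x" if w: "w \<in> E" "prefix w ([x..<e] @ F # v)" for w
  proof -
    have "set ([x..<e] @ F # v) \<inter> {M..<F} = {}" using assms(3,8) by auto
    then have "w \<notin> spent M F" using spent_not_prefix w(2) by blast
    then obtain a b where ab: "(a, b) \<in> J" "w = [a..<b]"
      using w(1) assms(6) by (auto simp: intervals_def)
    show ?thesis
    proof (cases "a < b")
      case True
      then have "a = x" "b \<le> e" using prefix_interval_run[of a b x e F v] w(2) ab(2) assms(1-4) by auto
      then show ?thesis using ab assms(7) by fastforce
    qed (simp add: ab)
  qed
  then show ?thesis using p assms(1,5) by (auto simp: component_def)
qed

lemma intervals_Un: "intervals (I \<union> J) = intervals I \<union> intervals J"
  by (auto simp: intervals_def)

lemma intervals_insert: "intervals (insert (a, b) J) = insert [a..<b] (intervals J)"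
  by (auto simp: intervals_def)

text \<open>\<open>N\<close> collects the words created earlier in this run; all start before
  \<open>x\<close>. At the start of a run \<open>q\<close> contains a separator, so
  \<open>q @ a\<close> is spent; afterwards \<open>q\<close> is the interval from \<open>p\<close>.
  The last hypothesis is a continuation that parses the remaining text with whatever dictionaries
  result.\<close>

lemma parse_run_pairs:
  "run_ok I J x ys \<Longrightarrow> run_end x ys \<le> M \<Longrightarrow> M < F \<Longrightarrow>
   flat tail = F # v \<Longrightarrow> set v \<inter> {M..<F} = {} \<Longrightarrow>
   (\<And>a b. (a, b) \<in> N \<Longrightarrow> a < x) \<Longrightarrow>
   intervals I \<subseteq> D \<Longrightarrow> E \<subseteq> intervals (J \<union> N) \<union> spent M F \<Longrightarrow>
   q = [p..<x] \<and> p < x \<or> q \<in> spent M F \<and> p \<le> x \<Longrightarrow>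
   (\<And>D' E' q'. D \<union> intervals (paired_words x ys) \<subseteq> D' \<Longrightarrow>
      E' \<subseteq> intervals (J \<union> N \<union> paired_words x ys \<union> bridging_words p ys) \<union> spent M F \<Longrightarrow>
      parse D' E' q' tail n) \<Longrightarrow>
   parse D E q (run_pairs x ys @ tail) (run_cost I x ys + n)"
proof (induction ys arbitrary: x N D E q p)
  case Nil
  show ?case using Nil.prems(10)[of D E q] Nil.prems(8) by (simp add: intervals_def)
next
  case (Cons yz ys)
  obtain y z where yz: "yz = (y, z)" by force
  define e where "e = run_end z ys"
  have ok: "x < y" "y < z" "y = Suc x \<or> (x, y) \<in> I" "z = Suc y \<or> (y, z) \<in> I"
    "\<And>b. (x, b) \<in> J \<Longrightarrow> b \<le> y \<or> e < b" "\<And>b. (y, b) \<in> J \<Longrightarrow> b \<le> z \<or> e < b" "run_ok I J z ys"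
    using Cons.prems(1) by (auto simp: yz e_def)
  have eM: "e \<le> M" using Cons.prems(2) by (simp add: yz e_def)
  have ze: "z \<le> e" using run_end_ge[OF ok(7)] by (simp add: e_def)
  note MF = \<open>M < F\<close> and vF = \<open>set v \<inter> {M..<F} = {}\<close>
  have rest: "flat (run_pairs z ys @ tail) = [z..<e] @ F # v"
    using flat_run_pairs[OF ok(7)] Cons.prems(4) by (simp add: e_def)
  have ye: "[y..<z] @ [z..<e] = [y..<e]" and xe: "[x..<y] @ [y..<e] = [x..<e]"
    using ok(1,2) ze by (simp_all add: upt_append_upt)
  have D: "[a..<b] \<in> D" if "(a, b) \<in> I" for a b using that Cons.prems(7) by (auto simp: intervals_def)
  have qa: "q @ [x..<y] = [p..<y] \<and> p < x \<or> q @ [x..<y] \<in> spent M F \<and> p \<le> x"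
    using Cons.prems(9)
  proof
    assume q: "q = [p..<x] \<and> p < x"
    then have "q @ [x..<y] = [p..<y]" using ok(1) by (simp add: upt_append_upt)
    then show ?thesis using q by simp
  qed (auto simp: spent_def)
  have E1: "insert (q @ [x..<y]) E \<subseteq> intervals (J \<union> insert (p, y) N) \<union> spent M F"
    using qa Cons.prems(8) by (auto simp: intervals_insert intervals_Un)
  have ca: "component D E [x..<y] ([x..<e] @ F # v)"
    using ok(1,2,3,5) ze eM MF vF Cons.prems(6,8) D
    by (intro component_interval[where J = "J \<union> N" and M = M]) (fastforce)+
  have cb: "component D (insert (q @ [x..<y]) E) [y..<z] ([y..<e] @ F # v)"
    using ok(1,2,4,6) ze eM MF vF Cons.prems(6) E1 D qa
    by (intro component_interval[where J = "J \<union> insert (p, y) N" and M = M]) (fastforce)+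
  define d where "d = (if \<exists>b\<ge>e. (x, b) \<in> I then e - x else 0)"
  have d: "d = 0 \<or> (\<exists>w\<in>D. \<exists>u. prefix u w \<and> prefix u ([x..<e] @ F # v) \<and> length u = d)"
  proof (cases "\<exists>b\<ge>e. (x, b) \<in> I")
    case True
    then obtain b where b: "b \<ge> e" "(x, b) \<in> I" by auto
    have "[x..<b] = [x..<e] @ [e..<b]" using b(1) ok(1,2) ze by (simp add: upt_append_upt)
    then have "prefix [x..<e] [x..<b]" by simp
    moreover have "length [x..<e] = d" using True by (simp add: d_def)
    moreover have "prefix [x..<e] ([x..<e] @ F # v)" by simp
    ultimately show ?thesis using D[OF b(2)] by blast
  qed (auto simp: d_def)
  have "parse (insert ([x..<y] @ [y..<z]) D) (insert (q @ [x..<y]) (insert ([x..<y] @ [y..<z]) E))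
     [y..<z] (run_pairs z ys @ tail) (run_cost I z ys + n)"
  proof (rule Cons.IH[where N = "insert (x, z) (insert (p, y) N)" and p = y])
    have xz: "[x..<y] @ [y..<z] = [x..<z]" using ok(1,2) by (simp add: upt_append_upt)
    show "insert (q @ [x..<y]) (insert ([x..<y] @ [y..<z]) E) \<subseteq>
        intervals (J \<union> insert (x, z) (insert (p, y) N)) \<union> spent M F"
      using E1 unfolding xz by (auto simp: intervals_insert intervals_Un)
    show "a < z" if "(a, b) \<in> insert (x, z) (insert (p, y) N)" for a b
      using that qa ok(1,2) Cons.prems(6) by fastforce
    show "parse D' E' q' tail n"
      if "insert ([x..<y] @ [y..<z]) D \<union> intervals (paired_words z ys) \<subseteq> D'"
        "E' \<subseteq> intervals (J \<union> insert (x, z) (insert (p, y) N) \<union> paired_words z ys \<union> bridging_words y ys) \<union> spent M F"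
      for D' E' q'
      using that unfolding xz
      by (intro Cons.prems(10)) (auto simp: yz intervals_insert intervals_Un)
  qed (use ok eM Cons.prems in \<open>auto simp: e_def\<close>)
  then have "parse D E q (([x..<y], [y..<z]) # run_pairs z ys @ tail) (d + (run_cost I z ys + n))"
    using ca cb d by (intro parse_Cons) (simp_all only: rest append.assoc[symmetric] ye xe)
  then show ?case unfolding yz d_def e_def by (simp only: run_pairs.simps run_cost.simps append_Cons add.assoc)
qed

lemma bridging_words_start: "run_ok I J x ys \<Longrightarrow> (a, b) \<in> bridging_words p ys \<Longrightarrow> p < run_end x ys \<Longrightarrow> a < run_end x ys"
proof (induction I J x ys arbitrary: p rule: run_ok.induct)
  case (2 I J x y z ys)
  then show ?case using run_end_ge[of I J z ys] by (cases "(a, b) = (p, y)") (fastforce)+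
qed simp

lemma paired_words_start: "run_ok I J x ys \<Longrightarrow> (a, b) \<in> paired_words x ys \<Longrightarrow> a < run_end x ys"
proof (induction I J x ys rule: run_ok.induct)
  case (2 I J x y z ys)
  then show ?case using run_end_ge[of I J z ys] by (cases "(a, b) = (x, z)") (fastforce)+
qed simp

lemma parse_text_pairs:
  "runs_ok M I J R \<Longrightarrow> M < F \<Longrightarrow> (\<And>a b. (a, b) \<in> J \<Longrightarrow> a < M) \<Longrightarrow>
   intervals I \<subseteq> D \<Longrightarrow> E \<subseteq> intervals J \<union> spent M F \<Longrightarrow> q \<in> spent M F \<Longrightarrow>
   parse D E q (text_pairs F R) (runs_cost I R)"
proof (induction F R arbitrary: I J D E q rule: text_pairs.induct)
  case (1 F)
  show ?case by (simp add: parse_Nil)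
next
  case (2 F x ys R)
  define I' where "I' = I \<union> paired_words x ys"
  define J' where "J' = J \<union> paired_words x ys \<union> bridging_words x ys"
  have ok: "run_ok I J x ys" "run_end x ys \<le> M" "runs_ok M I' J' R"
    using "2.prems"(1) by (auto simp: I'_def J'_def)
  have start: "a < M" if "(a, b) \<in> J'" for a b
  proof -
    have "a < run_end x ys" if "(a, b) \<in> bridging_words x ys"
    proof (cases ys)
      case (Cons yz zs)
      then have "x < run_end x ys" using ok(1) run_end_ge[of I J "snd yz" zs] by (cases yz) auto
      then show ?thesis using bridging_words_start[OF ok(1) that] by simp
    qed (use that in simp)
    then show ?thesis using that paired_words_start[OF ok(1)] ok(2) "2.prems"(3) unfolding J'_def
      by (meson UnE order_less_le_trans)
  qed
  define v where "v = flat (text_pairs (F + 2) R)"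
  have v: "set v \<inter> {M..<F + 2} = {}"
    using set_flat_text_pairs[OF ok(3), of "F + 2"] "2.prems"(2) by (simp add: v_def)
  have tail: "parse D' E' q' (([F], [Suc F]) # text_pairs (F + 2) R) (0 + runs_cost I' R)"
    if D': "D \<union> intervals (paired_words x ys) \<subseteq> D'" and E': "E' \<subseteq> intervals J' \<union> spent M F" for D' E' q'
  proof (rule parse_Cons)
    \<comment> \<open>At a separator only the empty word can match: spent words do not occur any
      more, and the dictionary intervals start below \<open>M\<close>.\<close>
    have c: "length w \<le> 1" if w: "w \<in> E'" "prefix w (G # u)" "F \<le> G" "set (G # u) \<inter> {M..<F} = {}" for w G u
    proof -
      have "w \<notin> spent M F" using spent_not_prefix[OF _ w(4)] w(2) by blast
      then obtain a b where ab: "(a, b) \<in> J'" "w = [a..<b]"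
        using w(1) E' by (auto simp: intervals_def)
      have "w = []"
      proof (rule ccontr)
        assume "w \<noteq> []"
        then have "a = G" using ab(2) w(2) by (auto simp: upt_rec[of a b] split: if_splits)
        then show False using start[OF ab(1)] w(3) "2.prems"(2) by simp
      qed
      then show ?thesis by simp
    qed
    have v': "set v \<inter> {M..<F} = {}" using v by auto
    show "component D' E' [F] ([F] @ [Suc F] @ flat (text_pairs (F + 2) R))"
      using c[of _ F "Suc F # v"] v' "2.prems"(2) by (auto simp: component_def v_def)
    have "\<not> prefix (q' @ [F]) (Suc F # v)"
    proof
      assume "prefix (q' @ [F]) (Suc F # v)"
      then have "F \<in> set (Suc F # v)" using set_mono_prefix by fastforce
      then show False using v "2.prems"(2) by auto
    qed
    then show "component D' (insert (q' @ [F]) E') [Suc F] ([Suc F] @ flat (text_pairs (F + 2) R))"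
      using c[of _ "Suc F" v] v' "2.prems"(2) by (auto simp: component_def v_def)
    show "parse (insert ([F] @ [Suc F]) D') (insert (q' @ [F]) (insert ([F] @ [Suc F]) E')) [Suc F]
        (text_pairs (F + 2) R) (runs_cost I' R)"
    proof (rule "2.IH"[OF ok(3)])
      have "spent M F \<subseteq> spent M (F + 2)" "q' @ [F] \<in> spent M (F + 2)" "[F] @ [Suc F] \<in> spent M (F + 2)"
        using "2.prems"(2) by (auto simp: spent_def)
      then show "insert (q' @ [F]) (insert ([F] @ [Suc F]) E') \<subseteq> intervals J' \<union> spent M (F + 2)"
        using E' by blast
      show "[Suc F] \<in> spent M (F + 2)" using "2.prems"(2) by (auto simp: spent_def)
      show "intervals I' \<subseteq> insert ([F] @ [Suc F]) D'"
        using D' "2.prems"(4) by (auto simp: I'_def intervals_Un)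
    qed (use start "2.prems"(2) in auto)
  qed simp
  have "parse D E q (run_pairs x ys @ ([F], [Suc F]) # text_pairs (F + 2) R) (run_cost I x ys + (0 + runs_cost I' R))"
  proof (rule parse_run_pairs[OF ok(1,2) "2.prems"(2), where N = "{}" and v = "Suc F # v" and p = x])
    show "set (Suc F # v) \<inter> {M..<F} = {}" using v "2.prems"(2) by auto
  qed (use "2.prems" tail in \<open>auto simp: v_def J'_def\<close>)
  then show ?case by (simp add: I'_def)
qed

section \<open>Lengths of texts\<close>

definition runs_len :: "run list \<Rightarrow> nat" where
  "runs_len R = (\<Sum>(x, ys)\<leftarrow>R. run_end x ys - x + 2)"

lemma runs_len_append [simp]: "runs_len (R @ R') = runs_len R + runs_len R'"
  by (simp add: runs_len_def)

lemma runs_len_simps [simp]: "runs_len [] = 0" "runs_len ((x, ys) # R) = run_end x ys - x + 2 + runs_len R"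
  by (simp_all add: runs_len_def)

lemma runs_len_concat_le: "(\<And>i. i < n \<Longrightarrow> runs_len (f i) \<le> c) \<Longrightarrow> runs_len (concat (map f [0..<n])) \<le> n * c"
proof (induction n)
  case (Suc n)
  then show ?case using Suc.IH Suc.prems[of n] by force
qed simp

lemma runs_len_concat_ge: "(\<And>i. f i \<noteq> []) \<Longrightarrow> n \<le> runs_len (concat (map f [0..<n]))"
proof (induction n)
  case (Suc n)
  have "1 \<le> runs_len (f n)" using Suc.prems[of n] by (cases "f n") auto
  then show ?case using Suc by simp
qed simp

text \<open>A Hoare triple: \<open>L\<close> bounds the words available to LZD from below, \<open>U\<close> those available to LZMW from
  above.\<close>

definition triple :: "nat \<Rightarrow> (nat \<times> nat) set \<Rightarrow> (nat \<times> nat) set \<Rightarrow> run list \<Rightarrow> (nat \<times> nat) set \<Rightarrow>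
    (nat \<times> nat) set \<Rightarrow> nat \<Rightarrow> bool" where
  "triple M L U R L' U' c \<longleftrightarrow> (\<forall>I J. L \<subseteq> I \<longrightarrow> J \<subseteq> U \<longrightarrow>
     (\<exists>I' J'. L' \<subseteq> I' \<and> J' \<subseteq> U' \<and>
       (\<forall>R'. runs_ok M I' J' R' \<longrightarrow> runs_ok M I J (R @ R')) \<and>
       (\<forall>R'. runs_cost I (R @ R') \<ge> c + runs_cost I' R')))"

lemma tripleD:
  "triple M L U R L' U' c \<Longrightarrow> L \<subseteq> I \<Longrightarrow> J \<subseteq> U \<Longrightarrow>
     \<exists>I' J'. L' \<subseteq> I' \<and> J' \<subseteq> U' \<and>
       (\<forall>R'. runs_ok M I' J' R' \<longrightarrow> runs_ok M I J (R @ R')) \<and>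
       (\<forall>R'. runs_cost I (R @ R') \<ge> c + runs_cost I' R')"
  by (simp add: triple_def)

lemma triple_Nil: "triple M L U [] L U 0"
  unfolding triple_def by (intro allI impI, rule_tac x = I in exI, rule_tac x = J in exI) simp

lemma triple_append:
  assumes "triple M L U R L' U' c" "triple M L' U' R' L'' U'' c'"
  shows "triple M L U (R @ R') L'' U'' (c + c')"
  unfolding triple_def
proof (intro allI impI)
  fix I J assume "L \<subseteq> I" "J \<subseteq> U"
  from tripleD[OF assms(1) this] obtain I' J' where 1: "L' \<subseteq> I'" "J' \<subseteq> U'"
    "\<forall>R'. runs_ok M I' J' R' \<longrightarrow> runs_ok M I J (R @ R')"
    "\<forall>R'. runs_cost I (R @ R') \<ge> c + runs_cost I' R'"
    by (elim exE conjE) (rule that)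
  from tripleD[OF assms(2) 1(1,2)] obtain I'' J'' where 2: "L'' \<subseteq> I''" "J'' \<subseteq> U''"
    "\<forall>R. runs_ok M I'' J'' R \<longrightarrow> runs_ok M I' J' (R' @ R)"
    "\<forall>R. runs_cost I' (R' @ R) \<ge> c' + runs_cost I'' R"
    by (elim exE conjE) (rule that)
  have "runs_cost I ((R @ R') @ S) \<ge> c + c' + runs_cost I'' S" for S
    using 1(4)[rule_format, of "R' @ S"] 2(4)[rule_format, of S] by simp
  then show "\<exists>I' J'. L'' \<subseteq> I' \<and> J' \<subseteq> U'' \<and>
      (\<forall>S. runs_ok M I' J' S \<longrightarrow> runs_ok M I J ((R @ R') @ S)) \<and>
      (\<forall>S. runs_cost I ((R @ R') @ S) \<ge> c + c' + runs_cost I' S)"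
    using 1(3) 2(1,2,3) by (intro exI[of _ I''] exI[of _ J'']) simp
qed

lemma triple_weaken:
  assumes t: "triple M L U R L' U' c" and sub: "L \<subseteq> K" "V \<subseteq> U" "K' \<subseteq> L'" "U' \<subseteq> V'"
  shows "triple M K V R K' V' c"
  unfolding triple_def
proof (intro allI impI)
  fix I J assume "K \<subseteq> I" "J \<subseteq> V"
  then have "L \<subseteq> I" "J \<subseteq> U" using sub by auto
  from tripleD[OF t this] obtain I' J' where "L' \<subseteq> I'" "J' \<subseteq> U'"
    "\<forall>R'. runs_ok M I' J' R' \<longrightarrow> runs_ok M I J (R @ R')"
    "\<forall>R'. runs_cost I (R @ R') \<ge> c + runs_cost I' R'"
    by (elim exE conjE) (rule that)
  moreover from this have "K' \<subseteq> I'" "J' \<subseteq> V'" using sub by auto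
  ultimately show "\<exists>I' J'. K' \<subseteq> I' \<and> J' \<subseteq> V' \<and>
       (\<forall>R'. runs_ok M I' J' R' \<longrightarrow> runs_ok M I J (R @ R')) \<and>
       (\<forall>R'. runs_cost I (R @ R') \<ge> c + runs_cost I' R')"
    by (intro exI conjI)
qed

lemma triple_loop:
  assumes "\<And>i. i < n \<Longrightarrow> triple M (L i) (U i) (f i) (L (Suc i)) (U (Suc i)) c"
  shows "triple M (L 0) (U 0) (concat (map f [0..<n])) (L n) (U n) (n * c)"
  using assms
proof (induction n)
  case 0
  show ?case by (simp add: triple_Nil)
next
  case (Suc n)
  then show ?case using triple_append[OF Suc.IH Suc.prems[of n]] by (simp add: add.commute)
qed

lemma run_ok_mono: "run_ok I J x ys \<Longrightarrow> I \<subseteq> I' \<Longrightarrow> J' \<subseteq> J \<Longrightarrow> run_ok I' J' x ys"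
  by (induction I J x ys rule: run_ok.induct) auto

lemma run_cost_mono: "I \<subseteq> I' \<Longrightarrow> run_cost I x ys \<le> run_cost I' x ys"
  by (induction I x ys rule: run_cost.induct) (auto intro!: add_mono)

text \<open>More words in \<open>I\<close> and fewer in \<open>J\<close> preserve
  \<open>run_ok\<close>, and more words in \<open>I\<close> can only raise the cost; so it suffices
  to check the run for the bounds \<open>L\<close> and \<open>U\<close>.\<close>

lemma triple_run:
  assumes "run_ok L U x ys" "run_end x ys \<le> M" "c \<le> run_cost L x ys"
    and "L' \<subseteq> L \<union> paired_words x ys" "U \<union> paired_words x ys \<union> bridging_words x ys \<subseteq> U'"
  shows "triple M L U [(x, ys)] L' U' c"
  unfolding triple_def
proof (intro allI impI)
  fix I J assume IJ: "L \<subseteq> I" "J \<subseteq> U"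
  have "c \<le> run_cost I x ys" using run_cost_mono[OF IJ(1)] assms(3) le_trans by blast
  then show "\<exists>I' J'. L' \<subseteq> I' \<and> J' \<subseteq> U' \<and> (\<forall>R'. runs_ok M I' J' R' \<longrightarrow> runs_ok M I J ([(x, ys)] @ R')) \<and>
      (\<forall>R'. runs_cost I ([(x, ys)] @ R') \<ge> c + runs_cost I' R')"
    using IJ assms(2,4,5) run_ok_mono[OF assms(1) IJ]
    by (intro exI[of _ "I \<union> paired_words x ys"] exI[of _ "J \<union> paired_words x ys \<union> bridging_words x ys"]) auto
qed

text \<open>The building step: two adjacent words become one. Only words from \<open>x\<close> need
  a condition, because a word from \<open>y\<close> either ends by \<open>z\<close> or reaches into
  the separator.\<close>

lemma triple_join:
  assumes "x < y" "y < z" "z \<le> M" "y = Suc x \<or> (x, y) \<in> L" "z = Suc y \<or> (y, z) \<in> L"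
    and "\<And>b. (x, b) \<in> U \<Longrightarrow> b \<le> y \<or> z < b"
  shows "triple M L U [(x, [(y, z)])] (insert (x, z) L) (insert (x, y) (insert (x, z) U)) 0"
  using assms by (intro triple_run) auto

section \<open>Interval sets described by block, offset and end\<close>

definition in_blocks :: "nat \<Rightarrow> (nat \<Rightarrow> nat \<Rightarrow> nat \<Rightarrow> bool) \<Rightarrow> (nat \<times> nat) set" where
  "in_blocks l P = {(j * l + a, b) | j a b. a < l \<and> P j a b}"

lemma in_blocks_iff: "a < l \<Longrightarrow> (j * l + a, b) \<in> in_blocks l P \<longleftrightarrow> P j a b"
proof
  assume a: "a < l" and "(j * l + a, b) \<in> in_blocks l P"
  then obtain j' a' where *: "j * l + a = j' * l + a'" "a' < l" "P j' a' b" by (auto simp: in_blocks_def)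
  have "j = j'" "a = a'"
    using arg_cong[OF *(1), of "\<lambda>x. x div l"] arg_cong[OF *(1), of "\<lambda>x. x mod l"] a *(2) by auto
  then show "P j a b" using * by simp
qed (auto simp: in_blocks_def)

lemma in_blocks_iff_0: "0 < l \<Longrightarrow> (j * l, b) \<in> in_blocks l P \<longleftrightarrow> P j 0 b"
  using in_blocks_iff[of 0 l j b P] by simp

lemma in_blocks_mono: "(\<And>j a b. a < l \<Longrightarrow> P j a b \<Longrightarrow> Q j a b) \<Longrightarrow> in_blocks l P \<subseteq> in_blocks l Q"
  unfolding in_blocks_def by blast

section \<open>The hard string\<close>

text \<open>The long word is \<open>[0..<q * l]\<close>, cut into \<open>q\<close> blocks of length \<open>l\<close>; dictionary words that end at \<open>M\<close>
  contain one letter more and therefore never match completely inside a sweep.\<close>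

locale hard_text =
  fixes q l M :: nat
  assumes q: "2 \<le> q" and l: "l = 3 * q + 1" and M: "M = q * l + 1"
begin

text \<open>The suffix of the block starting at offset \<open>3 * i\<close> is assembled without creating words that start
  at offsets not divisible by 3: those offsets must still parse as single letters in the sweeps.\<close>

definition suffix_runs :: "nat \<Rightarrow> nat \<Rightarrow> run list" where
  "suffix_runs j i =
     [(j * l + 3 * i, [(j * l + (3 * i + 1), j * l + (3 * i + 2))]),
      (j * l + 3 * i, [(j * l + (3 * i + 2), j * l + (3 * i + 3))]),
      (j * l + 3 * i, [(j * l + (3 * i + 3), Suc j * l)])]"

text \<open>The last four runs create the word from the start of block \<open>j\<close> to \<open>M\<close>. Prepending the whole block
  in one step would require the block itself as a word, and then the sweeps would proceed by whole
  blocks.\<close>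

definition block_runs :: "nat \<Rightarrow> run list" where
  "block_runs j = concat (map (\<lambda>k. suffix_runs j (q - Suc k)) [0..<q - 1]) @
     [(j * l + 3, [(Suc j * l, M)]), (j * l + 2, [(j * l + 3, M)]),
      (j * l + 1, [(j * l + 2, M)]), (j * l, [(j * l + 1, M)])]"

text \<open>In round \<open>r\<close> each block is parsed into a prefix of length \<open>3 * r + 1\<close>, two letters and the remaining
  suffix. The words this creates at the last three components start at offsets that no later round
  uses, so only the prefix grows from round to round.\<close>

definition sweep :: "nat \<Rightarrow> nat \<Rightarrow> (nat \<times> nat) list" where
  "sweep r j = concat (map (\<lambda>j. [(j * l + (3 * r + 1), j * l + (3 * r + 2)),
     (j * l + (3 * r + 3), Suc j * l)]) [j..<q])"

definition seed_runs :: "nat \<Rightarrow> nat \<Rightarrow> run list" where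
  "seed_runs r j = [(j * l, [(j * l + (3 * r + 2), j * l + (3 * r + 3))]),
     (j * l, [(j * l + (3 * r + 3), j * l + (3 * r + 4))])]"

definition round_runs :: "nat \<Rightarrow> run list" where
  "round_runs r = (0, sweep r 0) # concat (map (seed_runs r) [0..<q])"

definition all_runs :: "run list" where
  "all_runs = concat (map (\<lambda>k. block_runs (q - Suc k)) [0..<q]) @ concat (map round_runs [0..<q])"

definition suffix_word :: "nat \<Rightarrow> nat \<Rightarrow> nat \<Rightarrow> bool" where
  "suffix_word j a b \<longleftrightarrow> a = 0 \<and> b = M \<or> 0 < a \<and> a mod 3 = 0 \<and> a < 3 * q \<and> b = Suc j * l"

text \<open>Together with the words that end at \<open>M\<close> or beyond, these are the words that never change the parsing
  of a sweep.\<close>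

definition short :: "nat \<Rightarrow> nat \<Rightarrow> nat \<Rightarrow> bool" where
  "short j a b \<longleftrightarrow> b \<le> Suc (j * l + a) \<or> 0 < a \<and> a mod 3 = 0 \<and> b \<le> Suc j * l"

text \<open>The dictionary is built from right to left; \<open>(j0, a0)\<close> marks how far the
  construction has come.\<close>

definition lower_init :: "nat \<Rightarrow> nat \<Rightarrow> (nat \<times> nat) set" where
  "lower_init j0 a0 = in_blocks l (\<lambda>j a b. j < q \<and> (j0 < j \<or> j = j0 \<and> a0 \<le> a) \<and> suffix_word j a b)"

text \<open>While block \<open>j0\<close> is under construction, words reaching \<open>M\<close>
  start only in the finished blocks to its right.\<close>

definition upper_init :: "nat \<Rightarrow> nat \<Rightarrow> (nat \<times> nat) set" where
  "upper_init j0 a0 = in_blocks l (\<lambda>j a b. j0 < j \<and> (M \<le> b \<or> short j a b) \<or>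
     j = j0 \<and> a0 \<le> a \<and> short j a b)"

definition upper_block :: "nat \<Rightarrow> (nat \<times> nat) set" where
  "upper_block j0 = in_blocks l (\<lambda>j a b. j0 \<le> j \<and> (M \<le> b \<or> short j a b))"

text \<open>For \<open>r = 0\<close> the prefix has length 1 and is available as a letter.\<close>

definition lower_round :: "nat \<Rightarrow> (nat \<times> nat) set" where
  "lower_round r = in_blocks l (\<lambda>j a b. j < q \<and>
     (suffix_word j a b \<or> a = 0 \<and> 0 < r \<and> b = j * l + (3 * r + 1)))"

text \<open>The offsets from 1 to \<open>3 * r\<close> were used by earlier rounds and are left
  unrestricted, since sweep \<open>r\<close> starts components only at offset 0 and at
  \<open>3 * r + 1\<close> to \<open>3 * r + 3\<close>.\<close>

definition upper_round :: "nat \<Rightarrow> (nat \<times> nat) set" where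
  "upper_round r = in_blocks l (\<lambda>j a b. M \<le> b \<or> short j a b \<or> a = 0 \<and> b \<le> j * l + (3 * r + 1) \<or> 0 < a \<and> a \<le> 3 * r)"

text \<open>After the sweep of round \<open>r\<close>, the blocks before \<open>m\<close> already
  have their prefix lengthened for the next round.\<close>

definition lower_seed :: "nat \<Rightarrow> nat \<Rightarrow> (nat \<times> nat) set" where
  "lower_seed r m = in_blocks l (\<lambda>j a b. j < q \<and>
     (suffix_word j a b \<or> a = 0 \<and> b = j * l + (if j < m then 3 * r + 4 else 3 * r + 2)))"

definition upper_seed :: "nat \<Rightarrow> nat \<Rightarrow> (nat \<times> nat) set" where
  "upper_seed r m = in_blocks l (\<lambda>j a b. M \<le> b \<or> short j a b \<or>
     a = 0 \<and> b \<le> j * l + (if j < m then 3 * r + 4 else 3 * r + 2) \<or> 0 < a \<and> a \<le> 3 * r + 3)"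

section \<open>Building the dictionary of suffixes\<close>

lemma l_pos: "0 < l" using l by simp

lemma block_end: "j < q \<Longrightarrow> j * l + l < M"
proof -
  assume "j < q"
  then have "Suc j * l \<le> q * l" by (intro mult_le_mono1) simp
  then show ?thesis using M by simp
qed

text \<open>No word starts at \<open>x\<close> beforehand, so each of the three joins uses the word
  made by the previous one as its longest match.\<close>

lemma triple_suffix_runs:
  assumes j: "j < q" and i: "0 < i" "i < q"
  shows "triple M (lower_init j (3 * i + 3)) (upper_init j (3 * i + 3)) (suffix_runs j i)
    (lower_init j (3 * i)) (upper_init j (3 * i)) 0"
proof -
  define x where "x = j * l + 3 * i"
  define L U where "L = lower_init j (3 * i + 3)" and "U = upper_init j (3 * i + 3)"
  have a: "3 * i + 3 < l" using i l by simp
  have e: "j * l + l < M" using block_end[OF j] .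
  have noU: "(x, b) \<notin> U" for b
    using a by (simp add: x_def U_def upper_init_def in_blocks_iff)
  \<comment> \<open>Since \<open>l = 3 * q + 1\<close>, the part of the block from offset
    \<open>3 * q\<close> on is a single letter, which starts the chain of suffixes.\<close>
  have nxt: "Suc j * l = Suc (x + 3) \<or> (x + 3, Suc j * l) \<in> L"
  proof (cases "i = q - 1")
    case True
    then have "3 * i + 4 = l" using i l by simp
    then show ?thesis by (simp add: x_def)
  next
    case False
    then have "(j * l + (3 * i + 3), Suc j * l) \<in> L"
      using a i j by (simp only: L_def lower_init_def in_blocks_iff) (auto simp: suffix_word_def)
    then show ?thesis by (simp add: x_def add.assoc)
  qed
  have 1: "triple M L U [(x, [(x + 1, x + 2)])] (insert (x, x + 2) L) (insert (x, x + 1) (insert (x, x + 2) U)) 0"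
    (is "triple M L U _ ?L1 ?U1 0")
    using noU a e by (intro triple_join) (auto simp: x_def)
  have 2: "triple M ?L1 ?U1 [(x, [(x + 2, x + 3)])] (insert (x, x + 3) ?L1) (insert (x, x + 2) (insert (x, x + 3) ?U1)) 0"
    (is "triple M _ _ _ ?L2 ?U2 0")
    using noU a e by (intro triple_join) (auto simp: x_def)
  have 3: "triple M ?L2 ?U2 [(x, [(x + 3, Suc j * l)])] (insert (x, Suc j * l) ?L2) (insert (x, x + 3) (insert (x, Suc j * l) ?U2)) 0"
    (is "triple M _ _ _ ?L3 ?U3 0")
    using noU a e nxt by (intro triple_join) (auto simp: x_def)
  have lower: "lower_init j (3 * i) \<subseteq> ?L3"
  proof
    fix y assume "y \<in> lower_init j (3 * i)"
    then obtain j' a' b' where y: "y = (j' * l + a', b')" "a' < l" "j' < q" "j < j' \<or> j' = j \<and> 3 * i \<le> a'"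
      "suffix_word j' a' b'" by (auto simp: lower_init_def in_blocks_def)
    show "y \<in> ?L3"
    proof (cases "j < j' \<or> 3 * i + 3 \<le> a'")
      case True
      then have "y \<in> L" using y by (auto simp: L_def lower_init_def in_blocks_def)
      then show ?thesis by simp
    next
      case False
      then have *: "j' = j" "3 * i \<le> a'" "a' < 3 * i + 3" using y(4) by auto
      moreover have "a' mod 3 = 0" "b' = Suc j * l" using y(5) * i by (auto simp: suffix_word_def)
      moreover have "a' = 3 * i" using * \<open>a' mod 3 = 0\<close> by presburger
      ultimately show ?thesis using y(1) by (simp add: x_def)
    qed
  qed
  have upper: "?U3 \<subseteq> upper_init j (3 * i)"
  proof -
    have "U \<subseteq> upper_init j (3 * i)"
      unfolding U_def upper_init_def by (rule in_blocks_mono) auto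
    moreover have "(x, b) \<in> upper_init j (3 * i)" if "b \<le> Suc j * l" for b
      using that a i by (auto simp: x_def upper_init_def in_blocks_iff short_def)
    ultimately show ?thesis using a by (auto simp: x_def)
  qed
  have "suffix_runs j i = [(x, [(x + 1, x + 2)])] @ [(x, [(x + 2, x + 3)])] @ [(x, [(x + 3, Suc j * l)])]"
    by (simp add: suffix_runs_def x_def add.assoc)
  then have "triple M L U (suffix_runs j i) ?L3 ?U3 0"
    using triple_append[OF 1 triple_append[OF 2 3]] by simp
  then show ?thesis using lower upper by (auto simp: L_def U_def elim: triple_weaken)
qed

lemma triple_block_runs:
  assumes j: "j < q"
  shows "triple M (lower_init (Suc j) 0) (upper_block (Suc j)) (block_runs j) (lower_init j 0) (upper_block j) 0"
proof -
  have e: "j * l + l < M" using block_end[OF j] .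
  have l6: "6 < l" using q l by simp
  have loop: "triple M (lower_init j (3 * (q - 0))) (upper_init j (3 * (q - 0)))
      (concat (map (\<lambda>k. suffix_runs j (q - Suc k)) [0..<q - 1]))
      (lower_init j (3 * (q - (q - 1)))) (upper_init j (3 * (q - (q - 1)))) ((q - 1) * 0)"
  proof (rule triple_loop)
    fix k assume "k < q - 1"
    then have "3 * (q - k) = 3 * (q - Suc k) + 3" "0 < q - Suc k" "q - Suc k < q" by auto
    then show "triple M (lower_init j (3 * (q - k))) (upper_init j (3 * (q - k))) (suffix_runs j (q - Suc k))
        (lower_init j (3 * (q - Suc k))) (upper_init j (3 * (q - Suc k))) 0"
      using triple_suffix_runs[OF j] by simp
  qed
  define L U x where "L = lower_init j 3" and "U = upper_init j 3" and "x = j * l"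
  have q1: "3 * (q - (q - 1)) = 3" using q by simp
  \<comment> \<open>No suffix word starts at an offset of \<open>3 * q\<close> or more, so the state
    before block \<open>j\<close> is the finished state of block \<open>Suc j\<close>.\<close>
  have start: "lower_init j (3 * q) \<subseteq> lower_init (Suc j) 0" "upper_block (Suc j) \<subseteq> upper_init j (3 * q)"
    unfolding lower_init_def upper_init_def upper_block_def by (rule in_blocks_mono; auto simp: suffix_word_def)+
  have A: "triple M (lower_init (Suc j) 0) (upper_block (Suc j))
      (concat (map (\<lambda>k. suffix_runs j (q - Suc k)) [0..<q - 1])) L U 0"
    using loop start unfolding q1 L_def U_def by (auto elim: triple_weaken)
  have no': "(x + a, b) \<notin> U" if "a < 3" for a b
    using that l6 by (simp add: x_def U_def upper_init_def in_blocks_iff)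
  note no = no'[of 2] no'[of 1] no'[of 0]
  have ex: "x + l < M" using e by (simp add: x_def)
  have U3: "b \<le> Suc j * l" if "(x + 3, b) \<in> U" for b
    using that l6 by (auto simp: x_def U_def upper_init_def in_blocks_iff short_def)
  have y: "Suc j * l = x + l" by (simp add: x_def)
  have 1: "triple M L U [(x + 3, [(x + l, M)])] (insert (x + 3, M) L) (insert (x + 3, x + l) (insert (x + 3, M) U)) 0"
    (is "triple M _ _ _ ?L1 ?U1 0")
  proof (rule triple_join)
    show "x + 3 < x + l" "x + l < M" using l6 e by (auto simp: x_def)
    have "3 < l" using l6 by simp
    then have "(x + 3, Suc j * l) \<in> L"
      unfolding x_def L_def lower_init_def suffix_word_def using j q by (subst in_blocks_iff) simp_all
    then show "x + l = Suc (x + 3) \<or> (x + 3, x + l) \<in> L" unfolding y by simp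
    \<comment> \<open>The word to be appended is the one from the next block to \<open>M\<close>;
      after the last block it is a single letter, as \<open>M = q * l + 1\<close>.\<close>
    show "M = Suc (x + l) \<or> (x + l, M) \<in> L"
    proof (cases "Suc j = q")
      case True
      then show ?thesis using M y by auto
    next
      case False
      then have "(Suc j * l, M) \<in> L"
        using j l_pos unfolding L_def lower_init_def by (subst in_blocks_iff_0) (auto simp: suffix_word_def)
      then show ?thesis unfolding y by simp
    qed
    show "b \<le> x + l \<or> M < b" if "(x + 3, b) \<in> U" for b using U3[OF that] y by simp
  qed simp
  have 2: "triple M ?L1 ?U1 [(x + 2, [(x + 3, M)])] (insert (x + 2, M) ?L1) (insert (x + 2, x + 3) (insert (x + 2, M) ?U1)) 0"
    (is "triple M _ _ _ ?L2 ?U2 0")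
    using no l6 ex by (intro triple_join) auto
  have 3: "triple M ?L2 ?U2 [(x + 1, [(x + 2, M)])] (insert (x + 1, M) ?L2) (insert (x + 1, x + 2) (insert (x + 1, M) ?U2)) 0"
    (is "triple M _ _ _ ?L3 ?U3 0")
    using no l6 ex by (intro triple_join) auto
  have 4: "triple M ?L3 ?U3 [(x, [(x + 1, M)])] (insert (x, M) ?L3) (insert (x, x + 1) (insert (x, M) ?U3)) 0"
    (is "triple M _ _ _ ?L4 ?U4 0")
    using no l6 ex by (intro triple_join) auto
  have lower: "lower_init j 0 \<subseteq> ?L4"
  proof
    fix w assume "w \<in> lower_init j 0"
    then obtain j' a' b' where w: "w = (j' * l + a', b')" "a' < l" "j' < q" "j \<le> j'"
      "suffix_word j' a' b'" by (auto simp: lower_init_def in_blocks_def)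
    show "w \<in> ?L4"
    proof (cases "j < j' \<or> 3 \<le> a'")
      case True
      then have "w \<in> L" using w by (auto simp: L_def lower_init_def in_blocks_iff)
      then show ?thesis by simp
    next
      case False
      then have "j' = j" "a' < 3" using w(4) by auto
      then show ?thesis using w(1,5) by (auto simp: suffix_word_def x_def)
    qed
  qed
  have upper: "?U4 \<subseteq> upper_block j"
  proof -
    have "U \<subseteq> upper_block j"
      unfolding U_def upper_init_def upper_block_def by (rule in_blocks_mono) auto
    moreover have "(x + a, M) \<in> upper_block j" "(x + a, x + Suc a) \<in> upper_block j"
      "(x + 3, x + l) \<in> upper_block j" if "a < l" for a
      using that l6 by (auto simp: x_def upper_block_def in_blocks_iff short_def)
    from this(1)[of 0] this(1)[of 1] this(1)[of 2] this(1)[of 3]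
      this(2)[of 0] this(2)[of 1] this(2)[of 2] this(3)[of 0] calculation
    show ?thesis using l6 by (simp add: eval_nat_numeral)
  qed
  have "triple M L U ([(x + 3, [(x + l, M)])] @ [(x + 2, [(x + 3, M)])] @ [(x + 1, [(x + 2, M)])] @ [(x, [(x + 1, M)])])
      ?L4 ?U4 0"
    using triple_append[OF 1 triple_append[OF 2 triple_append[OF 3 4]]] by simp
  then have "triple M L U [(x + 3, [(x + l, M)]), (x + 2, [(x + 3, M)]), (x + 1, [(x + 2, M)]), (x, [(x + 1, M)])]
      (lower_init j 0) (upper_block j) 0"
    using lower upper by (auto elim: triple_weaken)
  from triple_append[OF A this] show ?thesis
    by (simp only: block_runs_def y flip: x_def) simp
qed

lemma triple_prologue:
  "triple M {} {} (concat (map (\<lambda>k. block_runs (q - Suc k)) [0..<q])) (lower_round 0) (upper_round 0) 0"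
proof -
  have "triple M (lower_init (q - 0) 0) (upper_block (q - 0)) (concat (map (\<lambda>k. block_runs (q - Suc k)) [0..<q]))
      (lower_init (q - q) 0) (upper_block (q - q)) (q * 0)"
  proof (rule triple_loop)
    fix k assume "k < q"
    then have "q - k = Suc (q - Suc k)" "q - Suc k < q" by auto
    then show "triple M (lower_init (q - k) 0) (upper_block (q - k)) (block_runs (q - Suc k))
        (lower_init (q - Suc k) 0) (upper_block (q - Suc k)) 0"
      using triple_block_runs by simp
  qed
  moreover have "lower_init (q - 0) 0 \<subseteq> {}" by (auto simp: lower_init_def in_blocks_def)
  moreover have "lower_round 0 \<subseteq> lower_init (q - q) 0" unfolding lower_round_def lower_init_def
    by (rule in_blocks_mono) auto
  moreover have "upper_block (q - q) \<subseteq> upper_round 0" unfolding upper_round_def upper_block_def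
    by (rule in_blocks_mono) auto
  ultimately show ?thesis by (auto elim!: triple_weaken)
qed

section \<open>The expensive sweeps\<close>

lemma sweep_Cons:
  "j < q \<Longrightarrow> sweep r j = (j * l + (3 * r + 1), j * l + (3 * r + 2)) #
     (j * l + (3 * r + 3), Suc j * l) # sweep r (Suc j)"
  by (simp add: sweep_def upt_conv_Cons)

lemma sweep_end: "sweep r q = []"
  by (simp add: sweep_def)

lemma run_end_sweep: "j \<le> q \<Longrightarrow> run_end (j * l) (sweep r j) = q * l"
  by (induction rule: inc_induct) (simp_all add: sweep_end sweep_Cons)

text \<open>At offsets \<open>3 * r + 1\<close> and \<open>3 * r + 2\<close>, not divisible by 3 and
  still fresh, only single letters and words beyond the end of the run exist. At
  \<open>3 * r + 3\<close> words stay within the block or exceed the run.\<close>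

lemma run_ok_sweep:
  assumes r: "r < q"
  shows "j \<le> q \<Longrightarrow> run_ok (lower_round r) (upper_round r) (j * l) (sweep r j)"
proof (induction rule: inc_induct)
  case base
  show ?case by (simp add: sweep_end)
next
  case (step j)
  let ?L = "lower_round r" and ?U = "upper_round r"
  have a: "3 * r + 3 < l" using r l by simp
  have eM: "q * l < M" using M by simp
  have end1: "run_end (Suc j * l) (sweep r (Suc j)) = q * l"
    using run_end_sweep[of "Suc j" r] step by simp
  have A: "3 * r + 1 = 1 \<or> (j * l, j * l + (3 * r + 1)) \<in> ?L"
    using step l_pos by (auto simp: lower_round_def in_blocks_iff_0)
  have E: "Suc j * l = Suc (j * l + (3 * r + 3)) \<or> (j * l + (3 * r + 3), Suc j * l) \<in> ?L"
  proof (cases "Suc r = q")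
    case True
    then have "l = 3 * r + 4" using l by simp
    then show ?thesis by simp
  next
    case False
    then have "3 * r + 3 < 3 * q" "(3 * r + 3) mod 3 = 0" using r by simp_all
    then have "(j * l + (3 * r + 3), Suc j * l) \<in> ?L"
      using step(2) unfolding lower_round_def in_blocks_iff[OF a] suffix_word_def by simp
    then show ?thesis ..
  qed
  have U0: "b \<le> j * l + (3 * r + 1) \<or> q * l < b" if "(j * l, b) \<in> ?U" for b
    using that eM unfolding upper_round_def in_blocks_iff_0[OF l_pos] short_def by auto
  have U1: "b \<le> j * l + (3 * r + 2) \<or> q * l < b" if "(j * l + (3 * r + 1), b) \<in> ?U" for b
  proof -
    have "(3 * r + 1) mod 3 \<noteq> 0" "3 * r + 1 < l" using a by presburger+
    moreover from this(2) that have "M \<le> b \<or> short j (3 * r + 1) b"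
      unfolding upper_round_def by (subst (asm) in_blocks_iff) auto
    ultimately show ?thesis using eM by (auto simp: short_def)
  qed
  have U2: "b \<le> j * l + (3 * r + 3) \<or> q * l < b" if "(j * l + (3 * r + 2), b) \<in> ?U" for b
  proof -
    have "(3 * r + 2) mod 3 \<noteq> 0" "3 * r + 2 < l" using a by presburger+
    moreover from this(2) that have "M \<le> b \<or> short j (3 * r + 2) b"
      unfolding upper_round_def by (subst (asm) in_blocks_iff) auto
    ultimately show ?thesis using eM by (auto simp: short_def)
  qed
  have U3: "b \<le> Suc j * l \<or> q * l < b" if "(j * l + (3 * r + 3), b) \<in> ?U" for b
    using that eM a unfolding upper_round_def in_blocks_iff[OF a] short_def by auto
  show ?case
    unfolding sweep_Cons[OF step(2)] run_ok.simps run_end.simps end1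
    using A E U0 U1 U2 U3 step(3) a by auto
qed

text \<open>The word from each block start to \<open>M\<close> outlasts the run, so block
  \<open>i\<close> costs \<open>(q - i) * l\<close>. Twice this triangular sum is at least the
  square times \<open>l\<close>.\<close>

lemma run_cost_sweep: "j \<le> q \<Longrightarrow> (q - j) * (q - j) * l \<le> 2 * run_cost (lower_round r) (j * l) (sweep r j)"
proof (induction rule: inc_induct)
  case base
  show ?case by (simp add: sweep_end)
next
  case (step j)
  have end1: "run_end (Suc j * l) (sweep r (Suc j)) = q * l"
    using run_end_sweep[of "Suc j" r] step by simp
  have "(j * l, M) \<in> lower_round r"
    using step(2) l_pos by (auto simp: lower_round_def in_blocks_iff_0 suffix_word_def)
  moreover have "q * l \<le> M" using M by simp
  ultimately have "run_cost (lower_round r) (j * l) (sweep r j) \<ge>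
      (q * l - j * l) + run_cost (lower_round r) (Suc j * l) (sweep r (Suc j))"
    unfolding sweep_Cons[OF step(2)] run_cost.simps run_end.simps end1 by auto
  moreover have "q * l - j * l = (q - j) * l" by (simp add: diff_mult_distrib)
  moreover obtain d where d: "q - j = Suc d" "q - Suc j = d" using step(2) by (metis Suc_diff_Suc)
  ultimately show ?case using step(3) by (simp add: algebra_simps)
qed

lemma paired_words_sweep:
  "j \<le> q \<Longrightarrow> (\<And>i. j \<le> i \<Longrightarrow> i < q \<Longrightarrow> (i * l, i * l + (3 * r + 2)) \<in> S \<and> (i * l + (3 * r + 2), Suc i * l) \<in> S) \<Longrightarrow>
    paired_words (j * l) (sweep r j) \<subseteq> S"
proof (induction rule: inc_induct)
  case (step j)
  then show ?case using step(4)[of j] by (auto simp: sweep_Cons)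
qed (simp add: sweep_end)

lemma paired_words_sweep_mem:
  "j \<le> q \<Longrightarrow> j \<le> i \<Longrightarrow> i < q \<Longrightarrow> (i * l, i * l + (3 * r + 2)) \<in> paired_words (j * l) (sweep r j)"
proof (induction rule: inc_induct)
  case (step j)
  then show ?case by (cases "i = j") (auto simp: sweep_Cons)
qed simp

lemma bridging_words_sweep:
  "j \<le> q \<Longrightarrow> (p, j * l + (3 * r + 1)) \<in> S \<Longrightarrow>
   (\<And>i. j \<le> i \<Longrightarrow> i < q \<Longrightarrow> (i * l + (3 * r + 1), i * l + (3 * r + 3)) \<in> S \<and>
      (i * l + (3 * r + 3), Suc i * l + (3 * r + 1)) \<in> S) \<Longrightarrow>
    bridging_words p (sweep r j) \<subseteq> S"
proof (induction arbitrary: p rule: inc_induct)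
  case (step j)
  then show ?case using step(5)[of j] by (auto simp: sweep_Cons)
qed (simp add: sweep_end)

lemma triple_sweep:
  assumes r: "r < q"
  shows "triple M (lower_round r) (upper_round r) [(0, sweep r 0)] (lower_seed r 0) (upper_seed r 0) (q * q * q)"
proof (rule triple_run)
  have a: "3 * r + 3 < l" "3 * r + 2 < l" "3 * r + 1 < l" using r l by simp_all
  show "run_ok (lower_round r) (upper_round r) 0 (sweep r 0)"
    using run_ok_sweep[OF r, of 0] by simp
  show "run_end 0 (sweep r 0) \<le> M" using run_end_sweep[of 0 r] M by simp
  \<comment> \<open>The bound \<open>2 * q \<le> l\<close> absorbs the factor 2 of
    \<open>run_cost_sweep\<close>.\<close>
  have "q * q * (2 * q) \<le> q * q * l" using l by (intro mult_le_mono2) simp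
  then have "2 * (q * q * q) \<le> q * q * l" by (simp add: algebra_simps)
  then show "q * q * q \<le> run_cost (lower_round r) 0 (sweep r 0)"
    using run_cost_sweep[of 0 r] unfolding mult_0 diff_zero by linarith
  show "lower_seed r 0 \<subseteq> lower_round r \<union> paired_words 0 (sweep r 0)"
  proof
    fix w assume "w \<in> lower_seed r 0"
    then obtain j a' b where w: "w = (j * l + a', b)" "a' < l" "j < q"
      "suffix_word j a' b \<or> a' = 0 \<and> b = j * l + (3 * r + 2)" by (auto simp: lower_seed_def in_blocks_def)
    show "w \<in> lower_round r \<union> paired_words 0 (sweep r 0)"
      using w(4)
    proof
      assume "suffix_word j a' b"
      then show ?thesis unfolding w(1) lower_round_def using w(2,3) by (simp add: in_blocks_iff)
    next
      assume "a' = 0 \<and> b = j * l + (3 * r + 2)"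
      then show ?thesis using paired_words_sweep_mem[of 0 j r] w(1,3) by simp
    qed
  qed
  have U: "upper_round r \<subseteq> upper_seed r 0"
    unfolding upper_round_def upper_seed_def by (rule in_blocks_mono) auto
  have mem: "(j * l + a', b) \<in> upper_seed r 0" if "0 < a'" "a' \<le> 3 * r + 3" for j a' b
    unfolding upper_seed_def using that a by (subst in_blocks_iff) auto
  have mem0: "(j * l, b) \<in> upper_seed r 0" if "b \<le> j * l + (3 * r + 2)" for j b
    unfolding upper_seed_def using that l_pos by (subst in_blocks_iff_0) auto
  have "paired_words (0 * l) (sweep r 0) \<subseteq> upper_seed r 0"
    by (intro paired_words_sweep conjI mem mem0) auto
  moreover have "bridging_words 0 (sweep r 0) \<subseteq> upper_seed r 0"
  proof (rule bridging_words_sweep)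
    show "(0, 0 * l + (3 * r + 1)) \<in> upper_seed r 0" using mem0[of "3 * r + 1" 0] by simp
  qed (auto intro!: mem simp del: mult_Suc add_2_eq_Suc' add_Suc_right)
  ultimately show "upper_round r \<union> paired_words 0 (sweep r 0) \<union> bridging_words 0 (sweep r 0) \<subseteq> upper_seed r 0"
    using U by simp
qed

text \<open>The sweep itself leaves a prefix of length \<open>3 * r + 2\<close>; two joins with
  single letters extend it to \<open>3 * Suc r + 1\<close>, the length used in the next
  round.\<close>

lemma triple_seed_runs:
  assumes r: "r < q" and m: "m < q"
  shows "triple M (lower_seed r m) (upper_seed r m) (seed_runs r m) (lower_seed r (Suc m)) (upper_seed r (Suc m)) 0"
proof -
  define x y where "x = m * l" and "y = m * l + (3 * r + 2)"
  have e: "y + 2 \<le> m * l + l" "x < y" "m * l + l < M" using r l block_end[OF m] by (auto simp: x_def y_def)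
  let ?L = "lower_seed r m" and ?U = "upper_seed r m"
  have L: "(x, y) \<in> ?L" using m l_pos unfolding x_def y_def lower_seed_def by (subst in_blocks_iff_0) auto
  have U: "b \<le> y \<or> y + 2 < b" if "(x, b) \<in> ?U" for b
    using that e l_pos unfolding x_def y_def upper_seed_def
    by (subst (asm) in_blocks_iff_0) (auto simp: short_def)
  have 1: "triple M ?L ?U [(x, [(y, y + 1)])] (insert (x, y + 1) ?L) (insert (x, y) (insert (x, y + 1) ?U)) 0"
    (is "triple M _ _ _ ?L1 ?U1 0")
    using L U e by (intro triple_join) fastforce+
  have 2: "triple M ?L1 ?U1 [(x, [(y + 1, y + 2)])] (insert (x, y + 2) ?L1) (insert (x, y + 1) (insert (x, y + 2) ?U1)) 0"
    (is "triple M _ _ _ ?L2 ?U2 0")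
    using U e by (intro triple_join) fastforce+
  have lower: "lower_seed r (Suc m) \<subseteq> ?L2"
  proof
    fix w assume "w \<in> lower_seed r (Suc m)"
    then obtain j a b where w: "w = (j * l + a, b)" "a < l" "j < q"
      "suffix_word j a b \<or> a = 0 \<and> b = j * l + (if j < Suc m then 3 * r + 4 else 3 * r + 2)"
      by (auto simp: lower_seed_def in_blocks_def)
    show "w \<in> ?L2"
    proof (cases "j = m \<and> a = 0 \<and> b = y + 2")
      case True
      then show ?thesis using w(1) by (simp add: x_def)
    next
      case False
      then have "suffix_word j a b \<or> a = 0 \<and> b = j * l + (if j < m then 3 * r + 4 else 3 * r + 2)"
        using w(4) by (auto simp: y_def less_Suc_eq split: if_splits)
      then have "w \<in> ?L" using w(1-3) by (simp add: lower_seed_def in_blocks_iff)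
      then show ?thesis by simp
    qed
  qed
  have "?U \<subseteq> upper_seed r (Suc m)"
    unfolding upper_seed_def by (rule in_blocks_mono) (auto split: if_splits)
  moreover have "(x, b) \<in> upper_seed r (Suc m)" if "b \<le> y + 2" for b
    using that l_pos unfolding x_def y_def upper_seed_def by (subst in_blocks_iff_0) auto
  ultimately have upper: "?U2 \<subseteq> upper_seed r (Suc m)" by simp
  have "seed_runs r m = [(x, [(y, y + 1)])] @ [(x, [(y + 1, y + 2)])]"
    by (simp add: seed_runs_def x_def y_def)
  then have "triple M ?L ?U (seed_runs r m) ?L2 ?U2 0" using triple_append[OF 1 2] by simp
  then show ?thesis using lower upper by (auto elim: triple_weaken)
qed

lemma triple_round:
  assumes r: "r < q"
  shows "triple M (lower_round r) (upper_round r) (round_runs r) (lower_round (Suc r)) (upper_round (Suc r)) (q * q * q)"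
proof -
  have "triple M (lower_seed r 0) (upper_seed r 0) (concat (map (seed_runs r) [0..<q]))
      (lower_seed r q) (upper_seed r q) (q * 0)"
    using triple_seed_runs[OF r] by (rule triple_loop)
  from triple_append[OF triple_sweep[OF r] this]
  have "triple M (lower_round r) (upper_round r) (round_runs r) (lower_seed r q) (upper_seed r q) (q * q * q)"
    by (simp add: round_runs_def)
  moreover have "lower_round (Suc r) \<subseteq> lower_seed r q"
    unfolding lower_round_def lower_seed_def by (rule in_blocks_mono) auto
  moreover have "upper_seed r q \<subseteq> upper_round (Suc r)"
    unfolding upper_round_def upper_seed_def by (rule in_blocks_mono) (auto split: if_splits)
  ultimately show ?thesis by (auto elim: triple_weaken)
qed

lemma triple_all_runs: "triple M {} {} all_runs (lower_round q) (upper_round q) (q * (q * q * q))"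
proof -
  have "triple M (lower_round 0) (upper_round 0) (concat (map round_runs [0..<q])) (lower_round q) (upper_round q) (q * (q * q * q))"
    using triple_round by (rule triple_loop)
  from triple_append[OF triple_prologue this] show ?thesis by (simp add: all_runs_def)
qed

section \<open>Running time and length of the hard string\<close>

definition hard_string :: "nat list" where
  "hard_string = flat (text_pairs (Suc M) all_runs)"

lemma runs_ok_all_runs: "runs_ok M {} {} all_runs" and runs_cost_all_runs: "q * (q * q * q) \<le> runs_cost {} all_runs"
proof -
  obtain I' J' where
    "\<forall>R'. runs_ok M I' J' R' \<longrightarrow> runs_ok M {} {} (all_runs @ R')"
    "\<forall>R'. runs_cost {} (all_runs @ R') \<ge> q * (q * q * q) + runs_cost I' R'"
    using tripleD[OF triple_all_runs order_refl order_refl] by (elim exE conjE) (rule that)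
  from this(1)[rule_format, of "[]"] this(2)[rule_format, of "[]"]
  show "runs_ok M {} {} all_runs" "q * (q * q * q) \<le> runs_cost {} all_runs" by simp_all
qed

lemma hard_string_time: "q * (q * q * q) \<le> lzd_time hard_string" "q * (q * q * q) \<le> lzmw_time hard_string"
proof -
  \<comment> \<open>\<open>[M]\<close> is a fictitious preceding component: runs use letters below
    \<open>M\<close>, separators start at \<open>Suc M\<close>, so \<open>M\<close> does not occur
    in the text.\<close>
  have "parse {} {} [M] (text_pairs (Suc M) all_runs) (runs_cost {} all_runs)"
    using runs_ok_all_runs by (intro parse_text_pairs) (auto simp: intervals_def spent_def)
  from parse_time_ge[OF this] runs_cost_all_runs
  show "q * (q * q * q) \<le> lzd_time hard_string" "q * (q * q * q) \<le> lzmw_time hard_string"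
    unfolding hard_string_def by linarith+
qed

lemma length_hard_string: "length hard_string = runs_len all_runs"
  unfolding hard_string_def runs_len_def using length_flat_text_pairs[OF runs_ok_all_runs] .

lemma length_hard_string_ge: "q \<le> length hard_string"
proof -
  have "q \<le> runs_len (concat (map round_runs [0..<q]))"
    by (rule runs_len_concat_ge) (simp add: round_runs_def)
  then show ?thesis by (simp add: length_hard_string all_runs_def)
qed

text \<open>Each block and each round has length \<open>O(q * q)\<close>. The constants 46 and 18
  are generous so that they add up to the cube 64.\<close>

lemma length_hard_string_le: "length hard_string \<le> 64 * (q * q * q)"
proof -
  have qq: "2 * q \<le> q * q" using q by (intro mult_le_mono1)
  have q4: "4 \<le> q * q" using mult_le_mono[OF q q] by simp
  have ql: "q * l = 3 * (q * q) + q" using l by (simp add: algebra_simps)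
  have suf: "runs_len (suffix_runs j i) \<le> 3 * q + 12" for i j
  proof -
    have "runs_len (suffix_runs j i) \<le> l + 11" by (simp add: suffix_runs_def)
    then show ?thesis using l by simp
  qed
  have block: "runs_len (block_runs j) \<le> 46 * (q * q)" if j: "j < q" for j
  proof -
    have "runs_len (concat (map (\<lambda>k. suffix_runs j (q - Suc k)) [0..<q - 1])) \<le> (q - 1) * (3 * q + 12)"
      using suf by (intro runs_len_concat_le)
    also have "\<dots> \<le> q * (3 * q + 12)" by (intro mult_le_mono1) simp
    also have "\<dots> = 3 * (q * q) + 12 * q" by (simp add: algebra_simps)
    finally have "runs_len (block_runs j) \<le> 3 * (q * q) + 12 * q + 4 * (M + 2)"
      by (simp add: block_runs_def)
    moreover have "4 * (M + 2) = 12 * (q * q) + 4 * q + 12" using M ql by simp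
    then have "3 * (q * q) + 12 * q + 4 * (M + 2) \<le> 46 * (q * q)" using qq q4 by linarith
    ultimately show ?thesis by (rule order_trans)
  qed
  have round: "runs_len (round_runs r) \<le> 18 * (q * q)" if r: "r < q" for r
  proof -
    have "runs_len (seed_runs r j) \<le> 6 * q + 12" for j
      using r by (simp add: seed_runs_def)
    then have "runs_len (concat (map (seed_runs r) [0..<q])) \<le> q * (6 * q + 12)"
      by (intro runs_len_concat_le)
    also have "\<dots> = 6 * (q * q) + 12 * q" by (simp add: algebra_simps)
    finally have "runs_len (concat (map (seed_runs r) [0..<q])) \<le> 6 * (q * q) + 12 * q" .
    moreover have "run_end 0 (sweep r 0) = 3 * (q * q) + q" using run_end_sweep[of 0 r] ql by simp
    moreover have "runs_len (round_runs r) =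
        run_end 0 (sweep r 0) + 2 + runs_len (concat (map (seed_runs r) [0..<q]))"
      by (simp add: round_runs_def)
    ultimately show ?thesis using qq q4 by linarith
  qed
  have "runs_len all_runs \<le> q * (46 * (q * q)) + q * (18 * (q * q))"
    unfolding all_runs_def runs_len_append using block round
    by (intro add_mono runs_len_concat_le) auto
  then show ?thesis by (simp add: length_hard_string)
qed

end

text \<open>The bound on \<open>n\<close> is the cube of \<open>4 * q\<close>, and its power
  \<open>4 / 3\<close> is 256 times the fourth power of \<open>q\<close>. The exponent
  \<open>4 / 3\<close> is then lowered to \<open>5 / 4\<close>, as \<open>n \<ge> 1\<close>.\<close>

lemma power_bound:
  fixes n q T :: nat
  assumes "n \<le> 64 * (q * q * q)" "q * (q * q * q) \<le> T"
  shows "1 / 256 * real n powr (5 / 4) \<le> real T"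
proof (cases "n = 0")
  case False
  then have q0: "0 < q" using assms(1) by (cases q) auto
  have "real n powr (5 / 4) \<le> real n powr (4 / 3)" using False by (intro powr_mono) auto
  also have "real n \<le> real (64 * (q * q * q))" using assms(1) by (simp only: of_nat_le_iff)
  then have "real n powr (4 / 3) \<le> real (64 * (q * q * q)) powr (4 / 3)" by (intro powr_mono2) auto
  also have "real (64 * (q * q * q)) = (4 * real q) powr 3" using q0 by (simp add: powr_numeral power3_eq_cube)
  also have "\<dots> powr (4 / 3) = (4 * real q) powr 4" unfolding powr_powr by simp
  also have "\<dots> = 256 * real (q * (q * q * q))" using q0 by (simp add: powr_numeral power4_eq_xxxx)
  also have "\<dots> \<le> 256 * real T" using assms(2) by (simp only: of_nat_le_iff mult_le_cancel_left_pos zero_less_numeral)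
  finally show ?thesis by simp
qed simp

theorem theorem3:
  shows "(\<exists>c::real. c > 0 \<and>
            (\<forall>N. \<exists>n\<ge>N. \<exists>s::nat list. length s = n \<and>
               real (lzd_time s) \<ge> c * real n powr (5 / 4))) \<and>
         (\<exists>c::real. c > 0 \<and>
            (\<forall>N. \<exists>n\<ge>N. \<exists>s::nat list. length s = n \<and>
               real (lzmw_time s) \<ge> c * real n powr (5 / 4)))"
proof -
  have "\<exists>s::nat list. N \<le> length s \<and> real (lzd_time s) \<ge> 1 / 256 * real (length s) powr (5 / 4) \<and>
      real (lzmw_time s) \<ge> 1 / 256 * real (length s) powr (5 / 4)" for N
  proof -
    \<comment> \<open>The string has at least \<open>q\<close> letters, so \<open>N\<close> as a
      lower bound on \<open>q\<close> makes it long enough.\<close>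
    define q l M where "q = max 2 N" and "l = 3 * q + 1" and "M = q * l + 1"
    interpret hard_text q l M by unfold_locales (simp_all add: q_def l_def M_def)
    have "N \<le> length hard_string" using length_hard_string_ge by (simp add: q_def)
    then show ?thesis
      using power_bound[OF length_hard_string_le hard_string_time(1)] power_bound[OF length_hard_string_le hard_string_time(2)] by blast
  qed
  then show ?thesis by (metis zero_less_divide_1_iff zero_less_numeral)
qed

end
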